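(* Let $\gamma=\begin{pmatrix}a&b\\c&d\end{pmatrix}\in\Gamma_0(2)$ and $F=\gamma(F_0)=\{\frac{a\tau+b}{c\tau+d}:\tau\in F_0\}$. Then $F$ contains a critical point of $E_2$ (a zero of $E_2'$) if and only if $c\neq0$.
   Context: $\mathbb{H}$ is the upper half plane. $E_2(\tau)=1-24\sum_{n\ge1}\sigma_1(n)e^{2\pi i n\tau}$, $\sigma_1(n)=\sum_{d\mid n}d$, is the normalized weight-2 Eisenstein series. $\Gamma_0(2)=\{\begin{pmatrix}a&b\\c&d\end{pmatrix}\in SL(2,\mathbb{Z}):2\mid c\}$ acting by Möbius transformations; $\gamma$ and $-\gamma$ give the same map. $F_0=\{\tau\in\mathbb{H}:0\le\operatorname{Re}\tau\le1,\ |\tau-\frac12|\ge\frac12\}$. *)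

theory Defs
  imports "HOL-Analysis.Analysis"
begin

definition upper_half_plane :: "complex set" where
  "upper_half_plane = {\<tau>. Im \<tau> > 0}"

definition sigma1 :: "nat \<Rightarrow> nat" where
  "sigma1 n = (\<Sum>d | d dvd n. d)"

text \<open>The sum over \<open>n \<ge> 1\<close> is indexed by \<open>Suc n\<close>. The series converges for \<open>\<tau>\<close> in the
  upper half plane; values elsewhere carry no meaning.\<close>

definition E2 :: "complex \<Rightarrow> complex" where
  "E2 \<tau> = 1 - 24 * (\<Sum>n. of_nat (sigma1 (Suc n)) * exp (2 * of_real pi * \<i> * of_nat (Suc n) * \<tau>))"

definition Gamma0 :: "nat \<Rightarrow> (int ^ 2 ^ 2) set" where
  "Gamma0 N = {A. det A = 1 \<and> int N dvd A $ 2 $ 1}"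

definition moebius_map :: "int ^ 2 ^ 2 \<Rightarrow> complex \<Rightarrow> complex" where
  "moebius_map A \<tau> = (of_int (A $ 1 $ 1) * \<tau> + of_int (A $ 1 $ 2)) /
                     (of_int (A $ 2 $ 1) * \<tau> + of_int (A $ 2 $ 2))"

definition F0 :: "complex set" where
  "F0 = {\<tau> \<in> upper_half_plane. 0 \<le> Re \<tau> \<and> Re \<tau> \<le> 1 \<and> norm (\<tau> - 1 / 2) \<ge> 1 / 2}"

end

theory Submission
  imports Defs "HOL-Complex_Analysis.Complex_Analysis" "HOL-Real_Asymp.Real_Asymp"
begin

text \<open>
  Differentiating \<open>E2 (\<gamma> t) = (c t + d)\<^sup>2 E2 t + 6 c (c t + d) / (\<pi> \<i>)\<close> shows that for \<open>c \<noteq> 0\<close> the critical points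
  of \<open>E2\<close> in \<open>\<gamma> F0\<close> correspond to the zeros in \<open>F0\<close> of
  \<open>P\<^sub>r(t) = (t - r)\<^sup>2 E2' t + 2 (t - r) E2 t + 6 / (\<pi> \<i>)\<close> with \<open>r = - d / c\<close>. As \<open>c\<close> is even and \<open>d\<close> is odd,
  \<open>r\<close> is different from \<open>0\<close> and \<open>1\<close>, and the order three map \<open>t \<mapsto> 1 / (1 - t)\<close>, which preserves \<open>F0\<close>, reduces to
  \<open>0 < r < 1\<close>. For real \<open>r\<close> the function \<open>P\<^sub>r\<close> has no zero on the imaginary axis (compare real and
  imaginary parts), hence none on the boundary of \<open>F0\<close>, and none near the cusps, locally uniformly in \<open>r\<close>. So the set of
  \<open>r\<close> in the open unit interval for which \<open>P\<^sub>r\<close> vanishes somewhere in \<open>F0\<close> is open (Hurwitz) and closed (compactness),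
  and it contains \<open>1/2\<close> by the intermediate value theorem on the line \<open>Re t = 1/2\<close>.
  For \<open>c = 0\<close> the series of \<open>E2'\<close> is dominated by its first term high up in \<open>F0\<close>, and near the cusps
  \<open>0\<close> and \<open>1\<close> one applies \<open>t \<mapsto> - 1 / t\<close>.
\<close>

section \<open>Fourier series\<close>

definition nome :: "complex \<Rightarrow> complex" where
  "nome t = exp (2 * of_real pi * \<i> * t)"

lemma norm_nome: "norm (nome t) = exp (-2 * pi * Im t)"
  by (simp add: nome_def)

lemma norm_nome_less_1: "Im t > 0 \<Longrightarrow> norm (nome t) < 1"
  by (simp add: norm_nome)

lemma nome_power: "nome t ^ n = nome (of_nat n * t)"
  by (simp add: nome_def exp_of_nat_mult [symmetric] mult_ac)

lemma nome_power_mult: "nome t ^ n = exp (2 * of_real pi * \<i> * of_nat n * t)"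
  by (simp add: nome_def exp_of_nat_mult [symmetric] mult_ac)

lemma nome_add_of_int: "nome (t + of_int n) = nome t"
proof -
  have "exp (2 * of_real pi * \<i> * of_int n) = 1"
    by (metis exp_2pi_1_int mult.commute mult.left_commute)
  then show ?thesis
    by (simp add: nome_def ring_distribs exp_add)
qed

lemma sigma1_0 [simp]: "sigma1 0 = 0"
  by (simp add: sigma1_def)

lemma sigma1_le_square: "sigma1 n \<le> n ^ 2"
proof (cases "n = 0")
  case False
  then have sub: "{d. d dvd n} \<subseteq> {1..n}"
    by (auto dest: dvd_imp_le intro: Nat.gr0I)
  have "sigma1 n \<le> (\<Sum>d\<in>{1..n}. d)"
    unfolding sigma1_def by (intro sum_mono2) (use sub in auto)
  also have "\<dots> \<le> (\<Sum>d\<in>{1..n}. n)"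
    by (intro sum_mono) auto
  finally show ?thesis
    by (simp add: power2_eq_square)
qed simp

text \<open>The coefficients grow at most like \<open>n ^ 3\<close>, so any geometric factor below 1
  wins. The extra weight \<open>n\<close> covers both the series of \<open>E2\<close> and that of
  its derivative.\<close>

lemma summable_n_sigma1:
  fixes x :: real
  assumes "0 \<le> x" "x < 1"
  shows "summable (\<lambda>n. real (n * sigma1 n) * x ^ n)"
proof (cases "x = 0")
  case True
  then have "(\<lambda>n. real (n * sigma1 n) * x ^ n) = (\<lambda>n. 0)"
    by (auto simp: fun_eq_iff power_0_left)
  then show ?thesis by simp
next
  case False
  have "summable (\<lambda>n. real n ^ 3 * x ^ n)"
  proof (rule summable_comparison_test_bigo)
    show "summable (\<lambda>n. norm (1 / real n ^ 2))"
      using inverse_power_summable[of 2, where 'a = real] by (simp add: field_simps)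
    have "0 < x" using False assms by simp
    then show "(\<lambda>n. real n ^ 3 * x ^ n) \<in> O(\<lambda>n. 1 / real n ^ 2)"
      using \<open>x < 1\<close> by real_asymp
  qed
  then show ?thesis
  proof (rule summable_comparison_test')
    fix n
    have "n * sigma1 n \<le> n * n ^ 2"
      using sigma1_le_square[of n] by simp
    then have "real (n * sigma1 n) \<le> real n ^ 3"
      by (simp add: power2_eq_square power3_eq_cube mult_ac flip: of_nat_mult)
    then show "norm (real (n * sigma1 n) * x ^ n) \<le> real n ^ 3 * x ^ n"
      using assms by (auto simp: abs_mult intro!: mult_right_mono)
  qed
qed

lemma summable_norm_n_sigma1:
  fixes x :: complex
  assumes "norm x < 1"
  shows "summable (\<lambda>n. norm (of_nat (n * sigma1 n) * x ^ n))"
  using summable_n_sigma1[of "norm x"] assms by (simp add: norm_mult norm_power)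

lemma summable_norm_sigma1:
  fixes x :: complex
  assumes "norm x < 1"
  shows "summable (\<lambda>n. norm (of_nat (sigma1 n) * x ^ n))"
proof (rule summable_comparison_test'[OF summable_norm_n_sigma1[OF assms]])
  fix n
  have "real (sigma1 n) \<le> real (n * sigma1 n)"
    by (cases n) auto
  then show "norm (norm (of_nat (sigma1 n) * x ^ n)) \<le> norm (of_nat (n * sigma1 n) * x ^ n)"
    unfolding norm_mult norm_of_nat real_norm_def abs_mult abs_norm_cancel by (intro mult_right_mono) auto
qed

lemma E2_eq_powser:
  assumes "Im t > 0"
  shows "E2 t = 1 - 24 * (\<Sum>n. of_nat (sigma1 n) * nome t ^ n)"
proof -
  have "(\<Sum>n. of_nat (sigma1 (Suc n)) * nome t ^ Suc n) = (\<Sum>n. of_nat (sigma1 n) * nome t ^ n)"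
    using suminf_split_head[OF summable_norm_cancel[OF summable_norm_sigma1[OF norm_nome_less_1[OF assms]]]]
    by simp
  then show ?thesis
    unfolding E2_def nome_power_mult by simp
qed

text \<open>The \<open>sigma1\<close> series under the Euler operator \<open>q d/dq\<close>; up to
  the factor \<open>-48 pi i\<close> it is \<open>E2'\<close> in terms of the nome.\<close>

definition E2_deriv_series :: "complex \<Rightarrow> complex" where
  "E2_deriv_series q = (\<Sum>n. of_nat (n * sigma1 n) * q ^ n)"

lemma open_Im_gt_0: "open {z. Im z > 0}"
  by (simp add: open_halfspace_Im_gt)

lemma has_field_derivative_E2:
  assumes "Im t > 0"
  shows "(E2 has_field_derivative (-48 * of_real pi * \<i> * E2_deriv_series (nome t))) (at t)"
proof -
  have q: "norm (nome t) < 1"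
    using assms by (rule norm_nome_less_1)
  have sm: "summable (\<lambda>n. of_nat (sigma1 n) * x ^ n)" if "norm x < 1" for x :: complex
    using that by (intro summable_norm_cancel[OF summable_norm_sigma1])
  have 1: "((\<lambda>x. \<Sum>n. of_nat (sigma1 n) * x ^ n) has_field_derivative
      (\<Sum>n. diffs (\<lambda>n. of_nat (sigma1 n)) n * nome t ^ n)) (at (nome t))"
    by (rule termdiffs_strong'[where K = 1]) (use sm q in auto)
  have "summable (\<lambda>n. of_nat (n * sigma1 n) * nome t ^ n)"
    by (rule summable_norm_cancel[OF summable_norm_n_sigma1[OF q]])
  \<comment> \<open>\<open>diffs\<close> lowers the exponent by one; multiplying by
    \<open>nome t\<close> restores it, the lost term at index 0 being 0.\<close>
  then have "E2_deriv_series (nome t) = (\<Sum>n. nome t * (diffs (\<lambda>n. of_nat (sigma1 n)) n * nome t ^ n))"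
    unfolding E2_deriv_series_def using suminf_split_head[of "\<lambda>n. of_nat (n * sigma1 n) * nome t ^ n"]
    by (simp add: diffs_def mult_ac ring_distribs)
  also have "\<dots> = nome t * (\<Sum>n. diffs (\<lambda>n. of_nat (sigma1 n)) n * nome t ^ n)"
    by (rule suminf_mult) (rule termdiff_converges[OF q sm])
  finally have 2: "nome t * (\<Sum>n. diffs (\<lambda>n. of_nat (sigma1 n)) n * nome t ^ n) = E2_deriv_series (nome t)" ..
  have 3: "(nome has_field_derivative (2 * of_real pi * \<i> * nome t)) (at t)"
    unfolding nome_def by (auto intro!: derivative_eq_intros)
  have "((\<lambda>t. 1 - 24 * (\<Sum>n. of_nat (sigma1 n) * nome t ^ n)) has_field_derivative
      - (24 * ((\<Sum>n. diffs (\<lambda>n. of_nat (sigma1 n)) n * nome t ^ n) * (2 * of_real pi * \<i> * nome t)))) (at t)"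
    by (rule derivative_eq_intros DERIV_chain2[where g = nome, OF 1 3] refl | simp)+
  also have "- (24 * ((\<Sum>n. diffs (\<lambda>n. of_nat (sigma1 n)) n * nome t ^ n) * (2 * of_real pi * \<i> * nome t)))
     = -48 * of_real pi * \<i> * E2_deriv_series (nome t)"
    unfolding 2[symmetric] by simp
  finally show ?thesis
    by (rule has_field_derivative_transform_within_open[OF _ open_Im_gt_0])
      (use assms in \<open>auto simp: E2_eq_powser\<close>)
qed

lemma deriv_E2: "Im t > 0 \<Longrightarrow> deriv E2 t = -48 * of_real pi * \<i> * E2_deriv_series (nome t)"
  by (rule DERIV_imp_deriv[OF has_field_derivative_E2])

lemma E2_add_of_int: "Im t > 0 \<Longrightarrow> E2 (t + of_int n) = E2 t"
  by (simp add: E2_eq_powser nome_add_of_int)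

lemma deriv_E2_add_of_int: "Im t > 0 \<Longrightarrow> deriv E2 (t + of_int n) = deriv E2 t"
  by (simp add: deriv_E2 nome_add_of_int)

lemma holomorphic_E2: "E2 holomorphic_on {z. Im z > 0}"
  using has_field_derivative_E2 by (auto simp: holomorphic_on_open[OF open_Im_gt_0])

lemma holomorphic_deriv_E2: "deriv E2 holomorphic_on {z. Im z > 0}"
  by (intro holomorphic_deriv holomorphic_E2 open_Im_gt_0)

text \<open>The family \<open>d * x ^ n\<close> over pairs with \<open>d\<close> dividing
  \<open>n\<close> converges absolutely. Summing over \<open>d\<close> first produces
  \<open>sigma1\<close>; writing \<open>n = (m + 1) * (k + 1)\<close>, \<open>d = k + 1\<close> and
  summing over \<open>k\<close> first produces the rows that the Lipschitz formula delivers.\<close>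

lemma lambert_has_sum:
  fixes x :: complex
  assumes x: "norm x < 1"
  shows "((\<lambda>m. \<Sum>k. of_nat (Suc k) * x ^ (Suc m * Suc k)) has_sum (\<Sum>n. of_nat (sigma1 n) * x ^ n)) UNIV"
proof -
  define f :: "nat \<times> nat \<Rightarrow> complex" where "f = (\<lambda>(n,d). of_nat d * x ^ n)"
  \<comment> \<open>Every number divides 0, so \<open>B 0\<close> is set to be empty; this agrees
    with \<open>sigma1 0 = 0\<close>, the default value of a sum over an infinite set.\<close>
  define B where "B = (\<lambda>n::nat. if n = 0 then {} else {d. d dvd n})"
  have fin: "finite (B n)" for n by (simp add: B_def)
  have sumB: "(\<Sum>d\<in>B n. of_nat d * c) = of_nat (sigma1 n) * c" for n and c :: complex
    by (auto simp: B_def sigma1_def sum_distrib_right)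
  have sumB': "(\<Sum>d\<in>B n. real d * c) = real (sigma1 n) * c" for n and c :: real
    by (auto simp: B_def sigma1_def sum_distrib_right)
  have "(\<lambda>p. norm (f p)) summable_on Sigma UNIV B"
    unfolding Infinite_Sum.abs_summable_on_Sigma_iff
  proof (intro conjI ballI)
    show "(\<lambda>y. norm (f (n, y))) summable_on B n" for n
      using fin by (rule summable_on_finite)
    have "(\<lambda>n. norm (\<Sum>\<^sub>\<infinity>y\<in>B n. norm (f (n, y)))) = (\<lambda>n. norm (of_nat (sigma1 n) * x ^ n))"
      using fin sumB' by (auto simp: f_def norm_mult norm_power)
    then show "(\<lambda>n. norm (\<Sum>\<^sub>\<infinity>y\<in>B n. norm (f (n, y)))) summable_on UNIV"
      using summable_norm_sigma1[OF x] by (simp add: norm_summable_imp_summable_on)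
  qed
  then have sm: "f summable_on Sigma UNIV B"
    by (rule abs_summable_summable)
  have "(f has_sum (\<Sum>n. of_nat (sigma1 n) * x ^ n)) (Sigma UNIV B)"
  proof (rule has_sum_SigmaI[OF _ _ sm])
    show "((\<lambda>y. f (n, y)) has_sum (of_nat (sigma1 n) * x ^ n)) (B n)" for n
      using has_sum_finite[OF fin, of "\<lambda>y. f (n, y)" n] sumB by (simp add: f_def)
    show "((\<lambda>n. of_nat (sigma1 n) * x ^ n) has_sum (\<Sum>n. of_nat (sigma1 n) * x ^ n)) UNIV"
      by (intro norm_summable_imp_has_sum summable_norm_sigma1 x summable_sums summable_norm_cancel[OF summable_norm_sigma1[OF x]])
  qed
  also have "?this \<longleftrightarrow> ((\<lambda>(m,k). of_nat (Suc k) * x ^ (Suc m * Suc k)) has_sum (\<Sum>n. of_nat (sigma1 n) * x ^ n)) (UNIV \<times> UNIV)"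
    by (rule has_sum_reindex_bij_witness[where i = "\<lambda>(m,k). (Suc m * Suc k, Suc k)" and j = "\<lambda>(n,d). (n div d - 1, d - 1)"])
       (auto simp: B_def f_def mult.commute[where 'a = nat] simp del: of_nat_Suc mult_Suc mult_Suc_right split: if_splits elim!: dvdE)
  finally have hs: "((\<lambda>(m,k). of_nat (Suc k) * x ^ (Suc m * Suc k)) has_sum (\<Sum>n. of_nat (sigma1 n) * x ^ n)) (UNIV \<times> UNIV)" .
  show ?thesis
  proof (rule has_sum_SigmaD[OF hs])
    fix m :: nat
    have "(\<lambda>k. of_nat (Suc k) * x ^ (Suc m * Suc k)) summable_on UNIV"
      using summable_on_SigmaD1[OF has_sum_imp_summable[OF hs], of m] by simp
    then show "((\<lambda>k. (\<lambda>(m,k). of_nat (Suc k) * x ^ (Suc m * Suc k)) (m, k)) has_sum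
        (\<Sum>k. of_nat (Suc k) * x ^ (Suc m * Suc k))) UNIV"
      using has_sum_infsum[of "\<lambda>k. of_nat (Suc k) * x ^ (Suc m * Suc k)" UNIV]
        sums_unique[OF has_sum_imp_sums[OF has_sum_infsum[of "\<lambda>k. of_nat (Suc k) * x ^ (Suc m * Suc k)" UNIV]]]
      by (simp only: prod.case simp_thms)
  qed
qed

section \<open>Partial fractions of the cotangent\<close>

lemma nonreal_notin_nonpos_Ints: "Im z \<noteq> 0 \<Longrightarrow> z \<notin> \<int>\<^sub>\<le>\<^sub>0"
  by (auto elim!: nonpos_Ints_cases)

lemma sin_pi_nonzero:
  fixes z :: complex
  assumes "Im z \<noteq> 0"
  shows "sin (of_real pi * z) \<noteq> 0"
  proof
  assume "sin (of_real pi * z) = 0"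
  then obtain n :: int where "of_real pi * z = of_real n * of_real pi"
    unfolding sin_eq_0 by auto
  then have "z = of_int n" by simp
  with assms show False by simp
qed

text \<open>Logarithmic derivative of
  \<open>Gamma z * Gamma (1 - z) = pi / sin (pi z)\<close>.\<close>

lemma Digamma_reflection:
  fixes z :: complex
  assumes "Im z \<noteq> 0"
  shows "Digamma (1 - z) - Digamma z = of_real pi * cot (of_real pi * z)"
proof -
  have z: "z \<notin> \<int>\<^sub>\<le>\<^sub>0" "1 - z \<notin> \<int>\<^sub>\<le>\<^sub>0"
    using assms by (auto intro!: nonreal_notin_nonpos_Ints)
  note s = sin_pi_nonzero[OF assms]
  have "((\<lambda>z. Gamma z * Gamma (1 - z)) has_field_derivative
      Gamma z * Gamma (1 - z) * (Digamma z - Digamma (1 - z))) (at z)"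
    using z by (auto intro!: derivative_eq_intros simp: algebra_simps)
  moreover have "((\<lambda>z. Gamma z * Gamma (1 - z)) has_field_derivative
      (- of_real pi * (of_real pi * cos (of_real pi * z)) / sin (of_real pi * z) ^ 2)) (at z)"
    unfolding Gamma_reflection_complex
    using s by (auto intro!: derivative_eq_intros simp: power2_eq_square)
  ultimately have eq: "of_real pi / sin (of_real pi * z) * (Digamma z - Digamma (1 - z)) =
      - of_real pi * (of_real pi * cos (of_real pi * z)) / sin (of_real pi * z) ^ 2"
    unfolding Gamma_reflection_complex[symmetric] by (rule DERIV_unique)
  have cancel: "D = - p * c / s" if "p / s * D = - p * (p * c) / s ^ 2" "p \<noteq> 0" "s \<noteq> 0" for p s D c :: complex
  proof -
    have "p * (D * s) = p * (- p * c)"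
      using that by (simp add: field_simps power2_eq_square)
    then have "D * s = - p * c"
      using that(2) unfolding mult_cancel_left by blast
    then show ?thesis using that(3) by (metis nonzero_mult_div_cancel_right)
  qed
  have "Digamma z - Digamma (1 - z) = - of_real pi * cos (of_real pi * z) / sin (of_real pi * z)"
    using eq by (rule cancel) (use s in auto)
  then show ?thesis
    by (simp add: cot_def algebra_simps)
qed

lemma Trigamma_reflection:
  fixes z :: complex
  assumes "Im z \<noteq> 0"
  shows "Polygamma 1 z + Polygamma 1 (1 - z) = of_real pi ^ 2 / sin (of_real pi * z) ^ 2"
proof -
  have z: "z \<notin> \<int>\<^sub>\<le>\<^sub>0" "1 - z \<notin> \<int>\<^sub>\<le>\<^sub>0"
    using assms by (auto intro!: nonreal_notin_nonpos_Ints)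
  note s = sin_pi_nonzero[OF assms]
  have op: "open {z. Im z \<noteq> 0}"
    by (intro open_Collect_neq continuous_intros)
  have "((\<lambda>z. Digamma (1 - z) - Digamma z) has_field_derivative
      (- Polygamma 1 (1 - z) - Polygamma 1 z)) (at z)"
    using z by (auto intro!: derivative_eq_intros)
  moreover have "((\<lambda>z. of_real pi * (cos (of_real pi * z) / sin (of_real pi * z))) has_field_derivative
      (- (of_real pi ^ 2) / sin (of_real pi * z) ^ 2)) (at z)"
  proof -
    have "((\<lambda>z. of_real pi * (cos (of_real pi * z) / sin (of_real pi * z))) has_field_derivative
      of_real pi * ((- sin (of_real pi * z) * of_real pi * sin (of_real pi * z) 
        - cos (of_real pi * z) * (cos (of_real pi * z) * of_real pi)) / (sin (of_real pi * z) * sin (of_real pi * z)))) (at z)"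
      using s by (auto intro!: derivative_eq_intros simp: algebra_simps)
    also have "of_real pi * ((- sin (of_real pi * z) * of_real pi * sin (of_real pi * z) 
        - cos (of_real pi * z) * (cos (of_real pi * z) * of_real pi)) / (sin (of_real pi * z) * sin (of_real pi * z)))
        = - (of_real pi ^ 2) * (sin (of_real pi * z) ^ 2 + cos (of_real pi * z) ^ 2) / sin (of_real pi * z) ^ 2"
      by (simp add: power2_eq_square algebra_simps add_divide_distrib diff_divide_distrib del: sin_cos_squared_add sin_cos_squared_add2 sin_cos_squared_add3)
    finally show ?thesis by simp
  qed
  then have "((\<lambda>z. Digamma (1 - z) - Digamma z) has_field_derivative
      (- (of_real pi ^ 2) / sin (of_real pi * z) ^ 2)) (at z)"
    by (rule has_field_derivative_transform_within_open[OF _ op])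
      (use assms in \<open>auto simp: Digamma_reflection cot_def\<close>)
  ultimately have "- Polygamma 1 (1 - z) - Polygamma 1 z = - (of_real pi ^ 2) / sin (of_real pi * z) ^ 2"
    by (rule DERIV_unique)
  then show ?thesis
    by (simp add: algebra_simps flip: minus_add_distrib)
qed

text \<open>With \<open>w = exp (i pi z)\<close> the sine is rational in \<open>w\<close> and the
  nome is \<open>w ^ 2\<close>. What is expanded is \<open>x / (1 - x) ^ 2\<close>, convergent
  because \<open>z\<close> lies in the upper half plane.\<close>

lemma pi_squared_over_sin_squared:
  assumes "Im z > 0"
  shows "of_real pi ^ 2 / sin (of_real pi * z) ^ 2 = - 4 * of_real pi ^ 2 * (\<Sum>k. of_nat (Suc k) * nome z ^ Suc k)"
proof -
  define w where "w = exp (\<i> * (of_real pi * z))"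
  have w0: "w \<noteq> 0" by (simp add: w_def)
  have w2: "nome z = w ^ 2"
    by (simp only: nome_def w_def exp_double[symmetric] mult_ac)
  have n: "norm (nome z) < 1"
    using assms by (rule norm_nome_less_1)
  then have "w ^ 2 \<noteq> 1" by (auto simp: w2)
  have sin: "sin (of_real pi * z) = (w - 1 / w) / (2 * \<i>)"
    by (simp add: sin_exp_eq w_def exp_minus field_simps)
  have "sin (of_real pi * z) ^ 2 = - ((1 - w ^ 2) ^ 2) / (4 * w ^ 2)"
    using w0 unfolding sin by (simp add: power2_eq_square field_simps)
  then have "of_real pi ^ 2 / sin (of_real pi * z) ^ 2 = - 4 * of_real pi ^ 2 * (w ^ 2 * (1 / (1 - w ^ 2) ^ 2))"
    using w0 \<open>w ^ 2 \<noteq> 1\<close> by simp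
  moreover have "(\<Sum>k. of_nat (Suc k) * nome z ^ Suc k) = nome z * (1 / (1 - nome z) ^ 2)"
    using sums_mult[OF geometric_deriv_sums[OF n], of "nome z"]
    by (simp add: sums_iff mult_ac)
  ultimately show ?thesis by (simp add: w2)
qed

text \<open>The Trigamma series at \<open>z\<close> runs over \<open>z + k\<close> with
  \<open>k >= 0\<close>, the one at \<open>1 - z\<close> over \<open>z - k\<close> with
  \<open>k >= 1\<close>. Reflection evaluates their total, and the unpaired term
  \<open>1 / z ^ 2\<close> is removed.\<close>

lemma lipschitz_formula:
  assumes "Im z > 0"
  shows "(\<lambda>n. 1 / (z + of_nat (Suc n)) ^ 2 + 1 / (z - of_nat (Suc n)) ^ 2) sums
    (- 4 * of_real pi ^ 2 * (\<Sum>k. of_nat (Suc k) * nome z ^ Suc k) - 1 / z ^ 2)"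
proof -
  have "z \<noteq> 0" "1 - z \<noteq> 0" using assms by auto
  have 1: "(\<lambda>k. 1 / (z + of_nat k) ^ 2) sums Polygamma 1 z"
    using Polygamma_LIMSEQ[of z 1] \<open>z \<noteq> 0\<close> by (simp add: inverse_eq_divide flip: numeral_2_eq_2)
  have 1: "(\<lambda>k. 1 / (z + of_nat (Suc k)) ^ 2) sums (Polygamma 1 z - 1 / z ^ 2)"
    using 1 by (subst sums_Suc_iff) simp
  have "(\<lambda>k. 1 / ((1 - z) + of_nat k) ^ 2) sums Polygamma 1 (1 - z)"
    using Polygamma_LIMSEQ[of "1 - z" 1] \<open>1 - z \<noteq> 0\<close> by (simp add: inverse_eq_divide flip: numeral_2_eq_2)
  also have "(\<lambda>k. 1 / ((1 - z) + of_nat k) ^ 2) = (\<lambda>k. 1 / (z - of_nat (Suc k)) ^ 2)"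
    by (intro ext arg_cong2[of _ _ _ _ "(/)"] refl) (simp add: power2_eq_square algebra_simps)
  finally have "(\<lambda>n. 1 / (z + of_nat (Suc n)) ^ 2 + 1 / (z - of_nat (Suc n)) ^ 2) sums
     (Polygamma 1 z - 1 / z ^ 2 + Polygamma 1 (1 - z))"
    by (intro sums_add 1)
  also have "Polygamma 1 z - 1 / z ^ 2 + Polygamma 1 (1 - z) =
       (Polygamma 1 z + Polygamma 1 (1 - z)) - 1 / z ^ 2" by simp
  also have "Polygamma 1 z + Polygamma 1 (1 - z) = - 4 * of_real pi ^ 2 * (\<Sum>k. of_nat (Suc k) * nome z ^ Suc k)"
    using assms by (subst Trigamma_reflection) (auto simp: pi_squared_over_sin_squared simp del: power_Suc of_nat_Suc)
  finally show ?thesis .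
qed

text \<open>Difference of the Digamma series at \<open>1 - z\<close> and \<open>1 + z\<close>: the
  harmonic terms cancel, and the recurrence from \<open>1 + z\<close> to \<open>z\<close> accounts
  for \<open>1 / z\<close>.\<close>

lemma cot_partial_fractions:
  fixes z :: complex
  assumes "Im z \<noteq> 0"
  shows "(\<lambda>n. 2 * z / (z ^ 2 - of_nat (Suc n) ^ 2)) sums (of_real pi * cot (of_real pi * z) - 1 / z)"
proof -
  have nz: "z \<noteq> 0" "1 + z \<noteq> 0" "1 - z \<noteq> 0"
    using assms by (auto simp: complex_eq_iff)
  have 1: "(\<lambda>n. inverse (of_nat (Suc n)) - inverse (1 - z + of_nat n)) sums (Digamma (1 - z) + euler_mascheroni)"
    using summable_sums[OF summable_Digamma[OF nz(3)]] by (simp add: Digamma_def)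
  have 2: "(\<lambda>n. inverse (of_nat (Suc n)) - inverse (1 + z + of_nat n)) sums (Digamma (1 + z) + euler_mascheroni)"
    using summable_sums[OF summable_Digamma[OF nz(2)]] by (simp add: Digamma_def)
  have "(\<lambda>n. inverse (1 + z + of_nat n) - inverse (1 - z + of_nat n)) sums (Digamma (1 - z) - Digamma (1 + z))"
    using sums_diff[OF 1 2] by simp
  also have "(\<lambda>n. inverse (1 + z + of_nat n) - inverse (1 - z + of_nat n)) =
      (\<lambda>n. 2 * z / (z ^ 2 - of_nat (Suc n) ^ 2))"
  proof
    fix n
    define N :: complex where "N = of_nat (Suc n)"
    have nz: "z + N \<noteq> 0" "N - z \<noteq> 0"
      using assms by (auto simp: complex_eq_iff N_def)
    have "inverse (z + N) - inverse (N - z) = ((N - z) - (z + N)) / ((z + N) * (N - z))"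
      using nz by (simp add: divide_simps)
    also have "\<dots> = 2 * z / - ((z + N) * (N - z))"
      by simp
    also have "- ((z + N) * (N - z)) = z ^ 2 - N ^ 2"
      by (simp add: power2_eq_square algebra_simps)
    finally have "inverse (z + N) - inverse (N - z) = 2 * z / (z ^ 2 - N ^ 2)" .
    moreover have "z + N = 1 + z + of_nat n" "N - z = 1 - z + of_nat n"
      by (simp_all add: N_def)
    ultimately show "inverse (1 + z + of_nat n) - inverse (1 - z + of_nat n) =
        2 * z / (z ^ 2 - of_nat (Suc n) ^ 2)"
      by (simp only: N_def)
  qed
  also have "Digamma (1 - z) - Digamma (1 + z) = of_real pi * cot (of_real pi * z) - 1 / z"
    using Digamma_plus1[OF nz(1)] Digamma_reflection[OF assms] by (simp add: algebra_simps)
  finally show ?thesis .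
qed

lemma cot_eq_exp:
  fixes z :: complex
  assumes "sin z \<noteq> 0"
  shows "cot z = \<i> * (1 + exp (- 2 * \<i> * z)) / (1 - exp (- 2 * \<i> * z))"
proof -
  define w where "w = exp (\<i> * z)"
  have w0: "w \<noteq> 0" by (simp add: w_def)
  have e: "exp (- 2 * \<i> * z) = 1 / w ^ 2"
  proof -
    have "exp (- 2 * \<i> * z) = exp (- (2 * (\<i> * z)))" by (simp add: mult.assoc)
    also have "\<dots> = 1 / exp (2 * (\<i> * z))" by (simp only: exp_minus inverse_eq_divide)
    also have "\<dots> = 1 / w ^ 2" by (simp only: exp_double w_def)
    finally show ?thesis .
  qed
  have s: "sin z = (w - 1 / w) / (2 * \<i>)" "cos z = (w + 1 / w) / 2"
    by (simp_all add: sin_exp_eq cos_exp_eq w_def exp_minus field_simps)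
  have "w ^ 2 \<noteq> 1"
    using assms w0 by (auto simp: s power2_eq_square field_simps)
  then have "w - 1 / w \<noteq> 0" "1 - 1 / w ^ 2 \<noteq> 0"
    using w0 by (auto simp: field_simps power2_eq_square)
  then show ?thesis
    unfolding cot_def s e using w0 by (simp add: field_simps power2_eq_square)
qed

text \<open>The arguments go to infinity in the lower half plane, where \<open>exp (- 2 i z)\<close>
  tends to 0.\<close>

lemma tendsto_cot_lower:
  assumes t: "Im t > 0"
  shows "(\<lambda>n. cot (of_real pi * ((of_nat n + 1 / 2) / t))) \<longlonglongrightarrow> \<i>"
proof -
  define v where "v = (\<lambda>n::nat. exp (- 2 * \<i> * (of_real pi * ((of_nat n + 1 / 2) / t))))"
  define c where "c = Im t / norm t ^ 2"
  have c: "c > 0" using t unfolding c_def by (intro divide_pos_pos) auto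
  have Im: "Im ((of_nat n + 1 / 2) / t) = - ((real n + 1 / 2) * c)" for n
    by (simp add: Im_divide cmod_power2 c_def)
  have "norm (v n) = exp (- 2 * pi * ((real n + 1 / 2) * c))" for n
    proof -
    have "Re (- 2 * \<i> * (of_real pi * ((of_nat n + 1 / 2) / t))) = 2 * pi * Im ((of_nat n + 1 / 2) / t)"
      by (simp only: times_complex.sel) simp
    then show ?thesis
      by (simp add: v_def Im)
  qed
  moreover have "(\<lambda>n. exp (- 2 * pi * ((real n + 1 / 2) * c))) \<longlonglongrightarrow> 0"
    using c by real_asymp
  ultimately have "v \<longlonglongrightarrow> 0"
    by (simp add: tendsto_norm_zero_iff[symmetric, of v])
  then have "(\<lambda>n. \<i> * (1 + v n) / (1 - v n)) \<longlonglongrightarrow> \<i> * (1 + 0) / (1 - 0)"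
    by (intro tendsto_intros) auto
  moreover have "cot (of_real pi * ((of_nat n + 1 / 2) / t)) = \<i> * (1 + v n) / (1 - v n)" for n
  proof -
    have "Im ((of_nat n + 1 / 2) / t) \<noteq> 0"
      unfolding Im using c by (smt (verit) mult_pos_pos of_nat_0_le_iff divide_pos_pos)
    then show ?thesis
      unfolding v_def by (intro cot_eq_exp sin_pi_nonzero)
  qed
  ultimately show ?thesis by simp
qed

section \<open>Inversion of the Eisenstein series\<close>

text \<open>The imaginary part controls \<open>a\<close>, and then the triangle inequality controls
  \<open>s\<close>. This makes the decay of lattice sums explicit in both indices.\<close>

lemma norm_lattice_point_ge:
  assumes t: "Im t > 0"
  obtains \<delta> where "\<delta> > 0" "\<And>a s. a \<ge> 0 \<Longrightarrow> \<delta> * (a + \<bar>s\<bar>) \<le> norm (of_real a * t + of_real s)"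
proof
  define K where "K = 1 + (1 + norm t) / Im t"
  have "K > 0" using t by (auto simp: K_def intro!: add_pos_nonneg)
  then show "1 / K > 0" by simp
  fix a s :: real
  assume a: "a \<ge> 0"
  define L where "L = norm (of_real a * t + of_real s)"
  have "a * Im t \<le> L"
    using abs_Im_le_cmod[of "of_real a * t + of_real s"] by (simp add: L_def)
  then have 1: "a \<le> L / Im t"
    using t by (simp add: field_simps)
  have "\<bar>s\<bar> = norm ((of_real a * t + of_real s) - of_real a * t)"
    by simp
  also have "\<dots> \<le> L + a * norm t"
    unfolding L_def using a by (intro order.trans[OF norm_triangle_ineq4]) (simp add: norm_mult)
  also have "a * norm t \<le> (L / Im t) * norm t"
    using 1 by (intro mult_right_mono) auto
  finally have "a + \<bar>s\<bar> \<le> K * L"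
    using 1 t by (simp add: K_def field_simps)
  then show "1 / K * (a + \<bar>s\<bar>) \<le> norm (of_real a * t + of_real s)"
    using \<open>K > 0\<close> unfolding L_def[symmetric] by (simp add: field_simps)
qed

text \<open>A telescoping difference replaces the inverse square up to an error of order four, which
  is absolutely summable over a lattice in the plane; order two is not.\<close>

lemma norm_square_minus_telescope_le:
  fixes p :: complex
  assumes "e > 0" "e \<le> norm p" "e \<le> norm (p - 1 / 2)" "e \<le> norm (p + 1 / 2)"
  shows "norm (1 / p ^ 2 - (1 / (p - 1 / 2) - 1 / (p + 1 / 2))) \<le> 1 / e ^ 4"
proof -
  have nz: "p \<noteq> 0" "p - 1 / 2 \<noteq> 0" "p + 1 / 2 \<noteq> 0"
    using assms by (metis norm_zero not_le)+
  have "1 / (p - 1 / 2) - 1 / (p + 1 / 2) = 1 / ((p - 1 / 2) * (p + 1 / 2))"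
    using diff_frac_eq[OF nz(2,3), of 1 1] by simp
  also have "1 / p ^ 2 - \<dots> = ((p - 1 / 2) * (p + 1 / 2) - p ^ 2) / (p ^ 2 * ((p - 1 / 2) * (p + 1 / 2)))"
    using diff_frac_eq[of "p ^ 2" "(p - 1 / 2) * (p + 1 / 2)" 1 1] nz by simp
  also have "(p - 1 / 2) * (p + 1 / 2) - p ^ 2 = - 1 / 4"
    by (simp add: power2_eq_square algebra_simps)
  also have "norm (- 1 / 4 / (p ^ 2 * ((p - 1 / 2) * (p + 1 / 2)))) =
      (1 / 4) / (norm p ^ 2 * (norm (p - 1 / 2) * norm (p + 1 / 2)))"
    by (simp add: norm_divide norm_mult norm_power)
  also have "\<dots> \<le> 1 / (e ^ 2 * (e * e))"
    using assms by (intro frac_le mult_mono power_mono mult_pos_pos) auto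
  also have "e ^ 2 * (e * e) = e ^ 4" by (simp add: power_numeral_reduce)
  finally show ?thesis .
qed

lemma inverse_squares_sums_complex: "(\<lambda>n. 1 / of_nat (Suc n) ^ 2) sums (of_real (pi ^ 2 / 6) :: complex)"
proof -
  have "(\<lambda>n. of_real (1 / (real n + 1) ^ 2) :: complex) sums of_real (pi ^ 2 / 6)"
    unfolding sums_of_real_iff using inverse_squares_sums by (simp add: add_ac)
  then show ?thesis by (simp add: add_ac)
qed

text \<open>The double series \<open>\<Sum>\<^sub>m \<Sum>\<^sub>n 1 / (m t + n)\<^sup>2\<close> is only conditionally convergent. Terms with
  \<open>m, n \<ge> 1\<close> and opposite signs of \<open>n\<close> are paired, and both indices are shifted by one.\<close>

definition pair_term :: "complex \<Rightarrow> nat \<Rightarrow> nat \<Rightarrow> complex" where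
  "pair_term t m n = 1 / (of_nat (Suc m) * t + of_nat (Suc n)) ^ 2 + 1 / (of_nat (Suc m) * t - of_nat (Suc n)) ^ 2"

text \<open>The value of row \<open>m\<close> according to the Lipschitz formula at
  \<open>(m + 1) t\<close>.\<close>

definition row_sum :: "complex \<Rightarrow> nat \<Rightarrow> complex" where
  "row_sum t m = - 4 * of_real pi ^ 2 * (\<Sum>k. of_nat (Suc k) * nome t ^ (Suc m * Suc k))
    - 1 / (of_nat (Suc m) * t) ^ 2"

lemma pair_term_sums_row_sum:
  assumes "Im t > 0"
  shows "pair_term t m sums row_sum t m"
proof -
  have "Im (of_nat (Suc m) * t) > 0" using assms by simp
  from lipschitz_formula[OF this] show ?thesis
    unfolding pair_term_def row_sum_def nome_power[symmetric] power_mult[symmetric] by simp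
qed

text \<open>The exponential parts form the Lambert series of \<open>sigma1\<close>, and
  \<open>- 4 pi^2 = (pi^2 / 6) * (- 24)\<close>; the subtracted inverse squares add up to
  \<open>zeta(2) / t ^ 2\<close>.\<close>

lemma row_sum_sums:
  assumes t: "Im t > 0"
  shows "row_sum t sums (of_real pi ^ 2 / 6 * (E2 t - 1 - 1 / t ^ 2))"
proof -
  note q = norm_nome_less_1[OF t]
  have 1: "(\<lambda>m. \<Sum>k. of_nat (Suc k) * nome t ^ (Suc m * Suc k)) sums (\<Sum>n. of_nat (sigma1 n) * nome t ^ n)"
    by (rule has_sum_imp_sums[OF lambert_has_sum[OF q]])
  have 2: "(\<lambda>m. 1 / t ^ 2 * (1 / of_nat (Suc m) ^ 2)) sums (1 / t ^ 2 * of_real (pi ^ 2 / 6))"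
    by (rule sums_mult[OF inverse_squares_sums_complex])
  have "(\<lambda>m. - 4 * of_real pi ^ 2 * (\<Sum>k. of_nat (Suc k) * nome t ^ (Suc m * Suc k)) - 1 / t ^ 2 * (1 / of_nat (Suc m) ^ 2)) sums
     (- 4 * of_real pi ^ 2 * (\<Sum>n. of_nat (sigma1 n) * nome t ^ n) - 1 / t ^ 2 * of_real (pi ^ 2 / 6))"
    by (intro sums_diff sums_mult 1 2)
  also have "(- 4 * of_real pi ^ 2 * (\<Sum>n. of_nat (sigma1 n) * nome t ^ n) - 1 / t ^ 2 * of_real (pi ^ 2 / 6)) =
      of_real pi ^ 2 / 6 * (E2 t - 1 - 1 / t ^ 2)"
    by (simp add: E2_eq_powser[OF t] algebra_simps)
  finally show ?thesis
    by (simp only: row_sum_def[abs_def] power_mult_distrib divide_divide_eq_left times_divide_eq_left mult_1 mult.commute[of "t ^ 2"] mult_1_right times_divide_eq_right)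
qed

lemma Im_minus_inverse: "Im (- 1 / t) = Im t / norm t ^ 2"
  by (simp add: Im_divide cmod_power2)

text \<open>Inversion exchanges the two indices of the lattice, so column sums at \<open>t\<close>
  become row sums at \<open>- 1 / t\<close>.\<close>

lemma pair_term_swap:
  assumes "t \<noteq> 0"
  shows "pair_term t m n = pair_term (- 1 / t) n m / t ^ 2"
proof -
  define M N where "M = (of_nat (Suc m) :: complex)" and "N = (of_nat (Suc n) :: complex)"
  have 1: "N * (- 1 / t) + M = (M * t - N) / t" "N * (- 1 / t) - M = - ((M * t + N) / t)"
    using assms by (simp_all add: field_simps)
  have 2: "(- x) ^ 2 = x ^ 2" for x :: complex by simp
  show ?thesis
    unfolding pair_term_def M_def[symmetric] N_def[symmetric] 1 2
    unfolding power_divide using assms by (simp add: add.commute add_divide_distrib)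
qed

text \<open>The difference \<open>tele z n - tele z (n + 1)\<close> approximates the paired term at \<open>z\<close>, since \<open>1 / w\<^sup>2\<close> is close to
  \<open>1 / (w - 1/2) - 1 / (w + 1/2)\<close>. It sums in closed form both along rows and along columns.\<close>

definition tele :: "complex \<Rightarrow> nat \<Rightarrow> complex" where
  "tele z n = 1 / (z + (of_nat n + 1 / 2)) - 1 / (z - (of_nat n + 1 / 2))"

definition tele_col :: "complex \<Rightarrow> nat \<Rightarrow> complex" where
  "tele_col t n = (1 / t) * (of_real pi * cot (of_real pi * ((of_nat n + 1 / 2) / t)) - 1 / ((of_nat n + 1 / 2) / t))"

text \<open>With \<open>a = n + 1/2\<close> the term is \<open>2 a / (a^2 - (m + 1)^2 t^2)\<close>,
  a partial fraction of the cotangent at \<open>a / t\<close>.\<close>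

lemma tele_column_sums:
  assumes t: "Im t > 0"
  shows "(\<lambda>m. tele (of_nat (Suc m) * t) n) sums tele_col t n"
proof -
  define a where "a = (of_nat n + 1 / 2 :: complex)"
  have t0: "t \<noteq> 0" using t by auto
  have "Im (a / t) = - ((real n + 1 / 2) * (Im t / norm t ^ 2))"
    by (simp add: Im_divide cmod_power2 a_def)
  moreover have "(real n + 1 / 2) * (Im t / norm t ^ 2) > 0"
    using t t0 by (intro mult_pos_pos divide_pos_pos add_nonneg_pos) auto
  ultimately have "Im (a / t) \<noteq> 0" by linarith
  from sums_mult[OF cot_partial_fractions[OF this], of "1 / t"]
  have "(\<lambda>m. 1 / t * (2 * (a / t) / ((a / t) ^ 2 - of_nat (Suc m) ^ 2))) sums tele_col t n"
    by (simp add: tele_col_def a_def)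
  also have "(\<lambda>m. 1 / t * (2 * (a / t) / ((a / t) ^ 2 - of_nat (Suc m) ^ 2))) = (\<lambda>m. tele (of_nat (Suc m) * t) n)"
  proof
    fix m
    define M :: complex where "M = of_nat (Suc m)"
    have "Im (M * t) = real (Suc m) * Im t" by (simp add: M_def)
    also have "\<dots> > 0" using t by simp
    finally have "Im (M * t) > 0" .
    then have nz: "M * t + a \<noteq> 0" "M * t - a \<noteq> 0"
      by (auto simp: complex_eq_iff a_def)
    have "tele (M * t) n = ((M * t - a) - (M * t + a)) / ((M * t + a) * (M * t - a))"
      using nz by (simp add: tele_def a_def[symmetric] diff_frac_eq)
    also have "\<dots> = 2 * a / - ((M * t + a) * (M * t - a))"
      by simp
    also have "- ((M * t + a) * (M * t - a)) = a ^ 2 - M ^ 2 * t ^ 2"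
      by (simp add: power2_eq_square algebra_simps)
    also have "a ^ 2 - M ^ 2 * t ^ 2 = t ^ 2 * ((a / t) ^ 2 - M ^ 2)"
      using t0 by (simp add: field_simps)
    also have "2 * a / (t ^ 2 * ((a / t) ^ 2 - M ^ 2)) = 1 / t * (2 * (a / t) / ((a / t) ^ 2 - M ^ 2))"
      by (simp add: power2_eq_square)
    finally show "1 / t * (2 * (a / t) / ((a / t) ^ 2 - of_nat (Suc m) ^ 2)) = tele (of_nat (Suc m) * t) n"
      unfolding M_def ..
  qed
  finally show ?thesis .
qed

text \<open>Unlike \<open>tele z n\<close>, which tends to 0, the column totals keep a nonzero
  limit: limit and sum do not commute, which is the origin of the anomaly.\<close>

lemma tele_col_tendsto:
  assumes t: "Im t > 0"
  shows "tele_col t \<longlonglongrightarrow> of_real pi * \<i> / t"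
proof -
  have "filterlim (\<lambda>n. of_nat n + 1 / 2 :: complex) at_infinity sequentially"
    by (intro tendsto_add_filterlim_at_infinity'[OF tendsto_of_nat]) auto
  then have "(\<lambda>n. t / (of_nat n + 1 / 2)) \<longlonglongrightarrow> 0"
    by (intro tendsto_divide_0[OF tendsto_const])
  then have "tele_col t \<longlonglongrightarrow> (1 / t) * (of_real pi * \<i> - 0)"
    unfolding tele_col_def[abs_def] by (intro tendsto_intros tendsto_cot_lower t) simp
  then show ?thesis by (simp add: mult_ac)
qed

lemma tele_tendsto_0: "tele z \<longlonglongrightarrow> 0"
proof -
  have "(\<lambda>n. 1 / (w + of_nat n :: complex)) \<longlonglongrightarrow> 0" for w
    by (intro tendsto_divide_0[OF tendsto_const] tendsto_add_filterlim_at_infinity[OF tendsto_const tendsto_of_nat])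
  from tendsto_add[OF this[of "z + 1 / 2"] this[of "1 / 2 - z"]]
  have "(\<lambda>n. 1 / (z + 1 / 2 + of_nat n) + 1 / (1 / 2 - z + of_nat n)) \<longlonglongrightarrow> 0" by simp
  also have "(\<lambda>n. 1 / (z + 1 / 2 + of_nat n) + 1 / (1 / 2 - z + of_nat n)) = tele z"
  proof
    fix n
    have "1 / (z - (of_nat n + 1 / 2)) = - (1 / - (z - (of_nat n + 1 / 2)))"
      by (simp only: minus_divide_right [symmetric] minus_minus)
    then show "1 / (z + 1 / 2 + of_nat n) + 1 / (1 / 2 - z + of_nat n) = tele z n"
      by (simp add: tele_def algebra_simps)
  qed
  finally show ?thesis .
qed

text \<open>Each entry decays with order four in the pair of indices, hence is dominated by a
  product of two convergent series of inverse squares.\<close>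

lemma pair_term_minus_tele_summable:
  assumes t: "Im t > 0"
  shows "(\<lambda>(m,n). pair_term t m n - (tele (of_nat (Suc m) * t) n - tele (of_nat (Suc m) * t) (Suc n))) summable_on UNIV \<times> UNIV"
proof -
  define f where "f = (\<lambda>(m,n). pair_term t m n - (tele (of_nat (Suc m) * t) n - tele (of_nat (Suc m) * t) (Suc n)))"
  obtain \<delta> where \<delta>: "\<delta> > 0" "\<And>a s. a \<ge> 0 \<Longrightarrow> \<delta> * (a + \<bar>s\<bar>) \<le> norm (of_real a * t + of_real s)"
    using norm_lattice_point_ge[OF t] by blast
  define g where "g = (\<lambda>(m,n). 2 / \<delta> ^ 4 * (1 / real (Suc m) ^ 2 * (1 / real (Suc n) ^ 2)))"
  have sq: "(\<lambda>n. 1 / real (Suc n) ^ 2) summable_on UNIV"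
    by (rule norm_summable_imp_summable_on)
      (use inverse_squares_sums in \<open>auto simp: sums_iff add_ac\<close>)
  have "(\<lambda>(m,n). 1 / real (Suc m) ^ 2 * (1 / real (Suc n) ^ 2)) summable_on UNIV \<times> UNIV"
  proof (rule summable_on_SigmaI)
    show "((\<lambda>n. case (m, n) of (m,n) \<Rightarrow> 1 / real (Suc m) ^ 2 * (1 / real (Suc n) ^ 2)) has_sum
        (1 / real (Suc m) ^ 2 * (\<Sum>\<^sub>\<infinity>n. 1 / real (Suc n) ^ 2))) UNIV" for m
      unfolding prod.case by (intro has_sum_cmult_right has_sum_infsum sq)
    show "(\<lambda>m. 1 / real (Suc m) ^ 2 * (\<Sum>\<^sub>\<infinity>n. 1 / real (Suc n) ^ 2)) summable_on UNIV"
      by (intro summable_on_cmult_left sq)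
  qed auto
  then have g: "g summable_on UNIV \<times> UNIV"
    using summable_on_cmult_right[of "\<lambda>(m,n). 1 / real (Suc m) ^ 2 * (1 / real (Suc n) ^ 2)" "UNIV \<times> UNIV" "2 / \<delta> ^ 4"]
    by (simp add: g_def case_prod_unfold)
  have "norm (f (m,n)) \<le> g (m,n)" for m n
  proof -
    define M N where "M = real (Suc m)" and "N = real (Suc n)"
    have MN: "M \<ge> 1" "N \<ge> 1" by (auto simp: M_def N_def)
    define z p r where "z = of_real M * t" and "p = z + of_real N" and "r = z - of_real N"
    \<comment> \<open>All six denominators below have the form \<open>z + s\<close> with
      \<open>abs s >= N / 2\<close>, because \<open>N >= 1\<close>.\<close>
    define e where "e = \<delta> * (M + N / 2)"
    have e: "e > 0" unfolding e_def using \<delta>(1) MN by (intro mult_pos_pos) auto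
    have E: "e \<le> norm (z + of_real s)" if "\<bar>s\<bar> \<ge> N / 2" for s
    proof -
      have "e \<le> \<delta> * (M + \<bar>s\<bar>)"
        unfolding e_def using that \<delta>(1) by (intro mult_left_mono) auto
      also have "\<dots> \<le> norm (z + of_real s)"
        unfolding z_def using MN by (intro \<delta>(2)) auto
      finally show ?thesis .
    qed
    have "e ^ 4 = \<delta> ^ 4 * ((M + N / 2) ^ 2) ^ 2"
      by (simp add: e_def power_mult_distrib flip: power_mult)
    also have "\<dots> \<ge> \<delta> ^ 4 * (M * N) ^ 2"
    proof (intro mult_left_mono power_mono)
      have "(M + N / 2) ^ 2 = M ^ 2 + M * N + (N / 2) ^ 2"
        by (simp add: power2_eq_square algebra_simps)
      also have "\<dots> \<ge> M * N" by simp
      finally show "M * N \<le> (M + N / 2) ^ 2" .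
    qed (use MN in auto)
    finally have e4: "1 / e ^ 4 \<le> 1 / (\<delta> ^ 4 * (M * N) ^ 2)"
      using \<delta> MN by (intro frac_le) auto
    \<comment> \<open>Since \<open>n + 1/2 = N - 1/2\<close>, the two \<open>tele\<close> terms
      regroup into one telescoping difference around \<open>p\<close> and one around
      \<open>r\<close>.\<close>
    have "f (m,n) = (1 / p ^ 2 - (1 / (p - 1 / 2) - 1 / (p + 1 / 2))) + (1 / r ^ 2 - (1 / (r - 1 / 2) - 1 / (r + 1 / 2)))"
    proof -
      have "of_nat (Suc m) * t = z" "of_nat (Suc n) = (of_real N :: complex)"
        and n: "of_nat n = (of_real N - 1 :: complex)"
        by (simp_all add: M_def N_def z_def)
      then show ?thesis
        by (simp add: n f_def pair_term_def tele_def p_def r_def algebra_simps del: of_nat_Suc)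
    qed
    also have "norm \<dots> \<le> 1 / e ^ 4 + 1 / e ^ 4"
    proof (intro order.trans[OF norm_triangle_ineq] add_mono norm_square_minus_telescope_le e)
      have "\<bar>N\<bar> \<ge> N / 2" "\<bar>N - 1/2\<bar> \<ge> N / 2" "\<bar>N + 1/2\<bar> \<ge> N / 2"
         "\<bar>-N\<bar> \<ge> N / 2" "\<bar>-N - 1/2\<bar> \<ge> N / 2" "\<bar>-N + 1/2\<bar> \<ge> N / 2" 
        using MN by auto
      note this[THEN E]
      then show "e \<le> norm p" "e \<le> norm (p - 1 / 2)" "e \<le> norm (p + 1 / 2)"
          "e \<le> norm r" "e \<le> norm (r - 1 / 2)" "e \<le> norm (r + 1 / 2)"
        unfolding p_def r_def by (simp_all add: algebra_simps)
    qed
    also have "\<dots> \<le> 1 / (\<delta> ^ 4 * (M * N) ^ 2) + 1 / (\<delta> ^ 4 * (M * N) ^ 2)"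
      by (intro add_mono e4)
    also have "\<dots> = g (m,n)"
      by (simp add: g_def M_def N_def power_mult_distrib)
    finally show ?thesis .
  qed
  then have "(\<lambda>x. norm (f x)) summable_on UNIV \<times> UNIV"
    by (intro Infinite_Sum.abs_summable_on_comparison_test'[OF g]) auto
  then show ?thesis
    unfolding f_def by (rule Infinite_Sum.abs_summable_summable)
qed

lemma has_sum_eq_sums:
  fixes f :: "nat \<Rightarrow> complex"
  assumes "f summable_on UNIV" "f sums S"
  shows "(f has_sum S) UNIV"
  using has_sum_infsum[OF assms(1)] has_sum_imp_sums[OF has_sum_infsum[OF assms(1)]] sums_unique2[OF assms(2)]
  by simp

text \<open>The two orders of summation of the corrected series agree; the correction itself contributes
  \<open>\<pi> \<i> / t\<close> to their difference, which is the failure of modularity.\<close>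

theorem E2_minus_inverse:
  assumes t: "Im t > 0"
  shows "E2 (- 1 / t) = t ^ 2 * E2 t + 6 * t / (of_real pi * \<i>)"
proof -
  have t0: "t \<noteq> 0" using t by auto
  have t': "Im (- 1 / t) > 0"
    unfolding Im_minus_inverse using t t0 by simp
  define d where "d = (\<lambda>(m,n). pair_term t m n - (tele (of_nat (Suc m) * t) n - tele (of_nat (Suc m) * t) (Suc n)))"
  have dsum: "d summable_on UNIV \<times> UNIV"
    unfolding d_def by (rule pair_term_minus_tele_summable[OF t])
  then obtain S where S: "(d has_sum S) (UNIV \<times> UNIV)"
    by (auto simp: summable_on_def)
  then have S': "((\<lambda>(n,m). d (m,n)) has_sum S) (UNIV \<times> UNIV)"
    by (subst (asm) has_sum_swap)
  \<comment> \<open>Rows first: the correction telescopes to its initial term.\<close>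
  have "((\<lambda>m. row_sum t m - tele (of_nat (Suc m) * t) 0) has_sum S) UNIV"
  proof (rule has_sum_SigmaD[OF S], rule has_sum_eq_sums)
    fix m
    show "(\<lambda>n. d (m, n)) summable_on UNIV"
      using summable_on_SigmaD1[of "curry d" UNIV "\<lambda>_. UNIV" m] dsum by (simp add: curry_def)
    show "(\<lambda>n. d (m, n)) sums (row_sum t m - tele (of_nat (Suc m) * t) 0)"
      using sums_diff[OF pair_term_sums_row_sum[OF t, of m] telescope_sums'[OF tele_tendsto_0[of "of_nat (Suc m) * t"]]]
      by (simp add: d_def)
  qed
  then have "(\<lambda>m. row_sum t m - tele (of_nat (Suc m) * t) 0) sums S"
    by (rule has_sum_imp_sums)
  moreover have "(\<lambda>m. row_sum t m - tele (of_nat (Suc m) * t) 0) sums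
      (of_real pi ^ 2 / 6 * (E2 t - 1 - 1 / t ^ 2) - tele_col t 0)"
    by (intro sums_diff row_sum_sums tele_column_sums t)
  ultimately have 1: "S = of_real pi ^ 2 / 6 * (E2 t - 1 - 1 / t ^ 2) - tele_col t 0"
    by (rule sums_unique2)
  \<comment> \<open>Columns first: the paired terms become rows at \<open>- 1 / t\<close>, and the
    closed forms of the correction telescope in \<open>n\<close>.\<close>
  have "((\<lambda>n. row_sum (- 1 / t) n / t ^ 2 - (tele_col t n - tele_col t (Suc n))) has_sum S) UNIV"
  proof (rule has_sum_SigmaD[OF S'], rule has_sum_eq_sums)
    fix n
    show "(\<lambda>m. (case (n, m) of (n,m) \<Rightarrow> d (m, n))) summable_on UNIV"
      using summable_on_SigmaD1[OF has_sum_imp_summable[OF S'], of n] by simp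
    have "(\<lambda>m. pair_term t m n) sums (row_sum (- 1 / t) n / t ^ 2)"
      unfolding pair_term_swap[OF t0] by (intro sums_divide pair_term_sums_row_sum t')
    then show "(\<lambda>m. (case (n, m) of (n,m) \<Rightarrow> d (m, n))) sums (row_sum (- 1 / t) n / t ^ 2 - (tele_col t n - tele_col t (Suc n)))"
      unfolding prod.case d_def by (intro sums_diff tele_column_sums t)
  qed
  then have "(\<lambda>n. row_sum (- 1 / t) n / t ^ 2 - (tele_col t n - tele_col t (Suc n))) sums S"
    by (rule has_sum_imp_sums)
  moreover have "(\<lambda>n. row_sum (- 1 / t) n / t ^ 2 - (tele_col t n - tele_col t (Suc n))) sums
      ((of_real pi ^ 2 / 6 * (E2 (- 1 / t) - 1 - 1 / (- 1 / t) ^ 2)) / t ^ 2 - (tele_col t 0 - of_real pi * \<i> / t))"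
    by (intro sums_diff sums_divide row_sum_sums t' telescope_sums' tele_col_tendsto t)
  ultimately have 2: "S = (of_real pi ^ 2 / 6 * (E2 (- 1 / t) - 1 - 1 / (- 1 / t) ^ 2)) / t ^ 2 - (tele_col t 0 - of_real pi * \<i> / t)"
    by (rule sums_unique2)
  \<comment> \<open>\<open>tele_col t 0\<close> occurs in both values of \<open>S\<close> and
    cancels.\<close>
  define p :: complex where "p = of_real pi"
  have p0: "p \<noteq> 0" by (simp add: p_def)
  have "p ^ 2 / 6 * (E2 t - 1 - 1 / t ^ 2) = (p ^ 2 / 6 * (E2 (- 1 / t) - 1 - t ^ 2)) / t ^ 2 + p * \<i> / t"
    using 1 2 by (simp add: p_def power_divide)
  then have "p * (p * (t ^ 2 * (E2 t - 1) - 1)) = p * (p * (E2 (- 1 / t) - 1 - t ^ 2) + 6 * \<i> * t)"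
    using t0 by (simp add: field_simps power2_eq_square)
  then have "p * (t ^ 2 * (E2 t - 1) - 1) = p * (E2 (- 1 / t) - 1 - t ^ 2) + 6 * \<i> * t"
    using p0 by (subst (asm) mult_cancel_left) auto
  then have "p * E2 (- 1 / t) = p * (t ^ 2 * E2 t) - 6 * \<i> * t"
    by (simp add: algebra_simps)
  then have "E2 (- 1 / t) = t ^ 2 * E2 t - 6 * \<i> * t / p"
    using p0 by (simp add: field_simps)
  also have "6 * \<i> * t / p = - (6 * t / (p * \<i>))"
    using p0 by (simp add: field_simps)
  finally show ?thesis by (simp add: p_def)
qed

section \<open>Quasimodularity\<close>

lemma moebius_denom_nonzero:
  fixes c d :: int
  assumes "Im t > 0" "c \<noteq> 0 \<or> d \<noteq> 0"
  shows "of_int c * t + of_int d \<noteq> 0"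
  using assms by (auto simp: complex_eq_iff)

lemma Im_moebius:
  fixes a b c d :: int
  assumes "a * d - b * c = 1"
  shows "Im ((of_int a * t + of_int b) / (of_int c * t + of_int d)) = Im t / norm (of_int c * t + of_int d) ^ 2"
proof -
  have "(of_int c * Re t + of_int d) * (of_int a * Im t) - (of_int a * Re t + of_int b) * (of_int c * Im t)
     = of_int (a * d - b * c) * Im t" by (simp add: algebra_simps)
  then show ?thesis
    unfolding Im_divide cmod_power2 using assms by (simp add: algebra_simps)
qed

lemma Im_moebius_pos:
  fixes a b c d :: int
  assumes "a * d - b * c = 1" "Im t > 0"
  shows "Im ((of_int a * t + of_int b) / (of_int c * t + of_int d)) > 0"
proof -
  have "c \<noteq> 0 \<or> d \<noteq> 0" using assms by auto
  then show ?thesis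
    unfolding Im_moebius[OF assms(1)] using assms moebius_denom_nonzero[of t c d]
    by (intro divide_pos_pos) auto
qed

text \<open>Euclidean algorithm on the bottom row: \<open>\<gamma> = \<gamma>' S T\<^sup>n\<close> where the bottom left entry of \<open>\<gamma>'\<close> is
  \<open>- (d mod c)\<close>.\<close>

theorem E2_moebius:
  fixes a b c d :: int
  assumes "a * d - b * c = 1" "Im t > 0"
  shows "E2 ((of_int a * t + of_int b) / (of_int c * t + of_int d)) =
    (of_int c * t + of_int d) ^ 2 * E2 t + 6 / (of_real pi * \<i>) * of_int c * (of_int c * t + of_int d)"
  using assms
proof (induction "nat \<bar>c\<bar>" arbitrary: a b c d t rule: less_induct)
  case less
  define \<kappa> where "\<kappa> = 6 / (of_real pi * \<i>)"
  show ?case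
  proof (cases "c = 0")
    case True
    then have "a * d = 1" using less.prems by simp
    then have "(a = 1 \<and> d = 1) \<or> (a = - 1 \<and> d = - 1)"
      using zmult_eq_1_iff by blast
    then show ?thesis
    proof
      assume "a = 1 \<and> d = 1"
      then show ?thesis
        using True E2_add_of_int[of t b] less.prems by simp
    next
      assume "a = - 1 \<and> d = - 1"
      then show ?thesis
        using True E2_add_of_int[of t "- b"] less.prems by simp
    qed
  next
    case False
    define n e where "n = d div c" and "e = d mod c"
    have d: "d = c * n + e" by (simp add: n_def e_def)
    define w where "w = t + of_int n"
    have w: "Im w > 0" using less.prems by (simp add: w_def)
    then have w0: "w \<noteq> 0" by auto
    have s: "Im (- 1 / w) > 0"
      unfolding Im_minus_inverse using w w0 by simp
    define j where "j = of_int c * t + of_int d"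
    have j: "j = of_int c * w + of_int e" by (simp add: j_def w_def d algebra_simps)
    have "nat \<bar>- e\<bar> < nat \<bar>c\<bar>"
      using False by (simp add: e_def abs_mod_less)
    moreover have "(a * n - b) * c - a * (- e) = 1"
      using less.prems by (simp add: d algebra_simps)
    ultimately have "E2 ((of_int (a * n - b) * (- 1 / w) + of_int a) / (of_int (- e) * (- 1 / w) + of_int c)) =
       (of_int (- e) * (- 1 / w) + of_int c) ^ 2 * E2 (- 1 / w) + \<kappa> * of_int (- e) * (of_int (- e) * (- 1 / w) + of_int c)"
      unfolding \<kappa>_def by (rule less.hyps) (rule s)
    moreover have "of_int (- e) * (- 1 / w) + of_int c = j / w"
      using w0 by (simp add: j field_simps)
    moreover have "of_int (a * n - b) * (- 1 / w) + of_int a = (of_int a * t + of_int b) / w"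
      using w0 by (simp add: field_simps) (simp add: w_def algebra_simps)
    moreover have "E2 (- 1 / w) = w ^ 2 * E2 t + \<kappa> * w"
      using E2_minus_inverse[OF w] E2_add_of_int[of t n] less.prems by (simp add: \<kappa>_def w_def)
    ultimately have "E2 (((of_int a * t + of_int b) / w) / (j / w)) =
        (j / w) ^ 2 * (w ^ 2 * E2 t + \<kappa> * w) - \<kappa> * of_int e * (j / w)"
      by simp
    also have "((of_int a * t + of_int b) / w) / (j / w) = (of_int a * t + of_int b) / j"
      using w0 by simp
    also have "(j / w) ^ 2 * (w ^ 2 * E2 t + \<kappa> * w) = j ^ 2 * E2 t + \<kappa> * j * (j / w)"
      using w0 by (simp add: power_divide ring_distribs) (simp add: power2_eq_square)
    \<comment> \<open>Since \<open>j = c * w + e\<close>, the anomalies of the inversion and of the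
      inductive step merge into one with coefficient \<open>c\<close>.\<close>
    also have "j ^ 2 * E2 t + \<kappa> * j * (j / w) - \<kappa> * of_int e * (j / w) = j ^ 2 * E2 t + \<kappa> * ((j - of_int e) / w) * j"
      using w0 by (simp add: field_simps)
    also have "(j - of_int e) / w = of_int c"
      using w0 by (simp add: j)
    finally show ?thesis
      unfolding j_def \<kappa>_def .
  qed
qed

text \<open>Obtained by differentiating the transformation law: up to nonvanishing factors, \<open>crit r\<close> with \<open>r = - d / c\<close>
  is the pullback of \<open>E2'\<close> under \<open>\<gamma>\<close>, and it only depends on the preimage \<open>r\<close> of the cusp \<open>\<infinity>\<close>.\<close>

definition crit :: "real \<Rightarrow> complex \<Rightarrow> complex" where
  "crit r t = (t - of_real r) ^ 2 * deriv E2 t + 2 * (t - of_real r) * E2 t + 6 / (of_real pi * \<i>)"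

lemma deriv_E2_moebius_aux:
  fixes a b c d :: int
  assumes det: "a * d - b * c = 1" and t: "Im t > 0"
  shows "deriv E2 ((of_int a * t + of_int b) / (of_int c * t + of_int d)) =
    (of_int c * t + of_int d) ^ 2 * ((of_int c * t + of_int d) ^ 2 * deriv E2 t
      + 2 * of_int c * (of_int c * t + of_int d) * E2 t + 6 / (of_real pi * \<i>) * of_int c ^ 2)"
proof -
  define \<kappa> where "\<kappa> = 6 / (of_real pi * \<i>)"
  define g where "g = (\<lambda>t. (of_int a * t + of_int b) / (of_int c * t + of_int d :: complex))"
  define j where "j = of_int c * t + of_int d"
  have j0: "j \<noteq> 0"
    unfolding j_def by (rule moebius_denom_nonzero) (use assms in auto)
  have D: "(E2 has_field_derivative deriv E2 z) (at z)" if "Im z > 0" for z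
    using has_field_derivative_E2[OF that] by (simp add: deriv_E2[OF that])
  have g: "(g has_field_derivative (1 / j ^ 2)) (at t)"
  proof -
    have "(g has_field_derivative ((of_int a * j - (of_int a * t + of_int b) * of_int c) / (j * j))) (at t)"
      unfolding g_def using j0 by (auto intro!: derivative_eq_intros simp: j_def)
    moreover have "of_int a * j - (of_int a * t + of_int b) * of_int c = of_int (a * d - b * c)"
      by (simp add: j_def algebra_simps)
    ultimately show ?thesis using det by (simp add: power2_eq_square)
  qed
  have "Im (g t) > 0"
    unfolding g_def using assms by (rule Im_moebius_pos)
  have "((\<lambda>t. E2 (g t)) has_field_derivative (deriv E2 (g t) * (1 / j ^ 2))) (at t)"
    by (rule DERIV_chain2[OF D[OF \<open>Im (g t) > 0\<close>] g])
  moreover have "((\<lambda>t. (of_int c * t + of_int d) ^ 2 * E2 t + \<kappa> * of_int c * (of_int c * t + of_int d))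
     has_field_derivative (j ^ 2 * deriv E2 t + 2 * of_int c * j * E2 t + \<kappa> * of_int c ^ 2)) (at t)"
    unfolding j_def by (rule derivative_eq_intros D[OF t] refl | simp)+ (simp add: algebra_simps power2_eq_square)
  then have "((\<lambda>t. E2 (g t)) has_field_derivative
      (j ^ 2 * deriv E2 t + 2 * of_int c * j * E2 t + \<kappa> * of_int c ^ 2)) (at t)"
    by (rule has_field_derivative_transform_within_open[OF _ open_Im_gt_0])
      (use t in \<open>auto simp: g_def \<kappa>_def E2_moebius[OF det]\<close>)
  ultimately have "deriv E2 (g t) * (1 / j ^ 2) = j ^ 2 * deriv E2 t + 2 * of_int c * j * E2 t + \<kappa> * of_int c ^ 2"
    by (rule DERIV_unique)
  then have "deriv E2 (g t) = j ^ 2 * (j ^ 2 * deriv E2 t + 2 * of_int c * j * E2 t + \<kappa> * of_int c ^ 2)"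
    using j0 by (simp add: field_simps)
  then show ?thesis
    unfolding g_def j_def \<kappa>_def .
qed

lemma deriv_E2_moebius:
  fixes a b c d :: int
  assumes det: "a * d - b * c = 1" and t: "Im t > 0" and c: "c \<noteq> 0"
  shows "deriv E2 ((of_int a * t + of_int b) / (of_int c * t + of_int d)) =
    (of_int c * t + of_int d) ^ 2 * of_int c ^ 2 * crit (- of_int d / of_int c) t"
proof -
  define s where "s = t - of_real (- of_int d / of_int c)"
  have "of_int c * t + of_int d = of_int c * s"
    using c by (simp add: s_def algebra_simps)
  then show ?thesis
    unfolding deriv_E2_moebius_aux[OF det t] crit_def s_def[symmetric]
    by (simp add: power2_eq_square algebra_simps)
qed

lemma crit_add_of_int:
  assumes "Im t > 0"
  shows "crit r (t + of_int n) = crit (r - of_int n) t"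
  using assms by (simp add: crit_def E2_add_of_int deriv_E2_add_of_int algebra_simps)

text \<open>The map \<open>t \<mapsto> 1 / (1 - t)\<close> of order three permutes the cusps \<open>0, 1, \<infinity>\<close> of \<open>F0\<close>.\<close>

lemma crit_rotate:
  assumes t: "Im t > 0" and r: "r \<noteq> 1"
  shows "crit (1 / (1 - r)) (1 / (1 - t)) = ((1 - t) / (1 - of_real r)) ^ 2 * crit r t"
proof -
  define \<kappa> where "\<kappa> = 6 / (of_real pi * \<i>)"
  have t1: "1 - t \<noteq> 0" using t by (auto simp: complex_eq_iff)
  have r1: "1 - of_real r \<noteq> (0 :: complex)" using r by (simp add: complex_eq_iff)
  have E: "E2 (1 / (1 - t)) = (1 - t) ^ 2 * E2 t - \<kappa> * (1 - t)"
    using E2_moebius[of 0 1 1 "-1" t] t by (simp add: \<kappa>_def)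
  have D: "deriv E2 (1 / (1 - t)) = (1 - t) ^ 2 * ((1 - t) ^ 2 * deriv E2 t - 2 * (1 - t) * E2 t + \<kappa>)"
    using deriv_E2_moebius_aux[of 0 1 1 "-1" t] t by (simp add: \<kappa>_def algebra_simps)
  define s \<rho> where "s = 1 - t" and "\<rho> = (1 - of_real r :: complex)"
  have diff: "1 / (1 - t) - of_real (1 / (1 - r)) = (\<rho> - s) / (s * \<rho>)"
    using t1 r1 by (simp add: s_def \<rho>_def diff_frac_eq)
  have tr: "t - of_real r = \<rho> - s" by (simp add: s_def \<rho>_def)
  have s0: "s \<noteq> 0" "\<rho> \<noteq> 0" using t1 r1 by (simp_all add: s_def \<rho>_def)
  have "crit (1 / (1 - r)) (1 / (1 - t)) =
      ((\<rho> - s) / (s * \<rho>)) ^ 2 * (s ^ 2 * (s ^ 2 * deriv E2 t - 2 * s * E2 t + \<kappa>)) +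
      2 * ((\<rho> - s) / (s * \<rho>)) * (s ^ 2 * E2 t - \<kappa> * s) + \<kappa>"
    unfolding crit_def diff E D by (simp add: s_def \<kappa>_def)
  also have "\<dots> = (s / \<rho>) ^ 2 * ((\<rho> - s) ^ 2 * deriv E2 t + 2 * (\<rho> - s) * E2 t + \<kappa>)"
    using s0 by (simp add: divide_simps) (simp add: power2_eq_square algebra_simps)
  finally show ?thesis
    unfolding crit_def tr \<kappa>_def s_def \<rho>_def .
qed

section \<open>The order three map on \<open>F0\<close>\<close>

lemma mem_F0_iff: "t \<in> F0 \<longleftrightarrow> Im t > 0 \<and> 0 \<le> Re t \<and> Re t \<le> 1 \<and> Re t \<le> Re t ^ 2 + Im t ^ 2"
proof -
  have "norm (t - 1 / 2) \<ge> 1 / 2 \<longleftrightarrow> (1 / 2) ^ 2 \<le> norm (t - 1 / 2) ^ 2"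
    by (subst power_mono_iff) auto
  also have "norm (t - 1 / 2) ^ 2 = Re t ^ 2 + Im t ^ 2 - Re t + (1 / 2) ^ 2"
    unfolding cmod_power2 by (simp add: power2_eq_square algebra_simps)
  finally show ?thesis
    by (auto simp: F0_def upper_half_plane_def)
qed

lemma Re_Im_rotate:
  "Re (1 / (1 - t)) = (1 - Re t) / ((1 - Re t) ^ 2 + Im t ^ 2)"
  "Im (1 / (1 - t)) = Im t / ((1 - Re t) ^ 2 + Im t ^ 2)"
  by (simp_all add: Re_divide Im_divide)

lemma Im_rotate_pos:
  assumes "Im t > 0"
  shows "Im (1 / (1 - t)) > 0"
  unfolding Re_Im_rotate using assms by (intro divide_pos_pos add_nonneg_pos) auto

text \<open>The conditions bounding \<open>F0\<close> are permuted: \<open>Re t <= 1\<close> becomes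
  nonnegativity of the real part, the circle condition becomes \<open>Re <= 1\<close>, and
  \<open>0 <= Re t\<close> becomes the circle condition.\<close>

lemma F0_rotate:
  assumes "t \<in> F0"
  shows "1 / (1 - t) \<in> F0"
proof -
  define N where "N = (1 - Re t) ^ 2 + Im t ^ 2"
  have t: "Im t > 0" "0 \<le> Re t" "Re t \<le> 1" "Re t \<le> Re t ^ 2 + Im t ^ 2"
    using assms by (auto simp: mem_F0_iff)
  have N: "N > 0" unfolding N_def using t by (intro add_nonneg_pos) auto
  have "1 - Re t \<le> N"
    using t by (simp add: N_def power2_eq_square algebra_simps)
  moreover have "((1 - Re t) / N) ^ 2 + (Im t / N) ^ 2 = 1 / N"
    using N by (simp add: power_divide add_divide_distrib[symmetric] N_def[symmetric]) (simp add: power2_eq_square)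
  ultimately show ?thesis
    unfolding mem_F0_iff Re_Im_rotate N_def[symmetric]
    using t N by (auto simp: divide_simps)
qed

lemma rotate_rotate_rotate:
  assumes "Im t > 0"
  shows "1 / (1 - 1 / (1 - 1 / (1 - t))) = t"
proof -
  have nz: "1 - t \<noteq> 0" "t \<noteq> 0" using assms by (auto simp: complex_eq_iff)
  have "1 - 1 / (1 - t) = - t / (1 - t)" using nz by (simp add: field_simps)
  then have "1 / (1 - 1 / (1 - t)) = (1 - t) / - t" by simp
  moreover have "1 - (1 - t) / - t = 1 / t" using nz by (simp add: field_simps)
  ultimately show ?thesis by (simp only:) simp
qed

lemma crit_zero_rotate:
  assumes r: "r \<noteq> 1" and "\<exists>t\<in>F0. crit (1 / (1 - r)) t = 0"
  shows "\<exists>t\<in>F0. crit r t = 0"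
proof -
  obtain s where s: "s \<in> F0" "crit (1 / (1 - r)) s = 0"
    using assms by blast
  \<comment> \<open>Applying the map twice inverts it, since it has order three.\<close>
  define t where "t = 1 / (1 - 1 / (1 - s))"
  have t: "t \<in> F0" unfolding t_def by (intro F0_rotate s)
  then have "Im t > 0" by (simp add: mem_F0_iff)
  have "1 / (1 - t) = s"
    unfolding t_def by (rule rotate_rotate_rotate) (use s in \<open>simp add: mem_F0_iff\<close>)
  then have "((1 - t) / (1 - of_real r)) ^ 2 * crit r t = 0"
    using crit_rotate[OF \<open>Im t > 0\<close> r] s by simp
  moreover have "1 - t \<noteq> 0" "1 - of_real r \<noteq> (0::complex)"
    using \<open>Im t > 0\<close> r by (auto simp: complex_eq_iff)
  ultimately show ?thesis using t by auto
qed

section \<open>Estimates near the cusps\<close>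

lemma sigma1_1: "sigma1 (Suc 0) = 1"
  by (simp add: sigma1_def)

lemma sigma1_2: "sigma1 2 = 3"
proof -
  have "{d::nat. d dvd 2} = {1, 2}"
    using prime_nat_iff two_is_prime_nat by auto
  then show ?thesis by (simp add: sigma1_def)
qed

text \<open>Equality for \<open>n = 0\<close> and \<open>n = 1\<close> makes 6 the smallest possible
  base; from \<open>n = 2\<close> on the cubic bound suffices.\<close>

lemma n_sigma1_le_power: "Suc n * sigma1 (Suc n) \<le> 6 ^ n"
proof -
  consider "n = 0" | "n = 1" | "n \<ge> 2" by linarith
  then show ?thesis
  proof cases
    case 1
    then show ?thesis by (simp add: sigma1_1)
  next
    case 2
    then show ?thesis using sigma1_2 by (simp add: numeral_2_eq_2)
  next
    case 3
    have "Suc n * sigma1 (Suc n) \<le> Suc n * Suc n ^ 2"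
      using sigma1_le_square by (rule mult_le_mono2)
    also have "Suc n * Suc n ^ 2 = Suc n ^ 3"
      by (simp add: power_numeral_reduce)
    also have "Suc n ^ 3 \<le> 6 ^ n"
      using 3
    proof (induction n rule: dec_induct)
      case (step n)
      have "Suc (Suc n) ^ 3 \<le> 6 * Suc n ^ 3"
        using step.hyps by (simp add: power3_eq_cube algebra_simps)
      also have "\<dots> \<le> 6 * 6 ^ n" using step by simp
      finally show ?case by simp
    qed simp
    finally show ?thesis .
  qed
qed

lemma E2_deriv_series_minus_first_le:
  assumes q: "norm q < 1 / 6"
  shows "norm (E2_deriv_series q - q) \<le> 6 * norm q ^ 2 / (1 - 6 * norm q)"
proof -
  let ?a = "\<lambda>n. of_nat (n * sigma1 n) * q ^ n"
  have sn: "summable (\<lambda>n. norm (?a n))"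
    using q by (intro summable_norm_n_sigma1) auto
  have "?a sums E2_deriv_series q"
    unfolding E2_deriv_series_def by (rule summable_sums[OF summable_norm_cancel[OF sn]])
  then have "(\<lambda>n. ?a (n + 2)) sums (E2_deriv_series q - (\<Sum>n<2. ?a n))"
    by (rule sums_split_initial_segment)
  also have "(\<Sum>n<2. ?a n) = q"
    by (simp add: numeral_2_eq_2 sigma1_1)
  finally have 1: "(\<lambda>n. ?a (n + 2)) sums (E2_deriv_series q - q)" .
  have le: "norm (?a (n + 2)) \<le> 6 * norm q ^ 2 * (6 * norm q) ^ n" for n
  proof -
    have "real ((n + 2) * sigma1 (n + 2)) \<le> real (6 ^ (n + 1))"
      using n_sigma1_le_power[of "n + 1"] by (simp only: of_nat_le_iff) simp
    then have "real ((n + 2) * sigma1 (n + 2)) * norm q ^ (n + 2) \<le> 6 ^ (n + 1) * norm q ^ (n + 2)"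
      by (intro mult_right_mono) auto
    then show ?thesis
      by (simp only: norm_mult norm_of_nat norm_power) (simp add: power_mult_distrib power2_eq_square mult_ac)
  qed
  have geo: "(\<lambda>n. 6 * norm q ^ 2 * (6 * norm q) ^ n) sums (6 * norm q ^ 2 * (1 / (1 - 6 * norm q)))"
    using q by (intro sums_mult geometric_sums) auto
  have sn2: "summable (\<lambda>n. norm (?a (n + 2)))"
    using sn by (rule summable_ignore_initial_segment)
  have "norm (E2_deriv_series q - q) \<le> (\<Sum>n. norm (?a (n + 2)))"
    unfolding sums_unique[OF 1] by (rule summable_norm[OF sn2])
  also have "\<dots> \<le> (\<Sum>n. 6 * norm q ^ 2 * (6 * norm q) ^ n)"
    by (intro suminf_le le sn2 sums_summable[OF geo])
  also have "\<dots> = 6 * norm q ^ 2 / (1 - 6 * norm q)"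
    using sums_unique[OF geo] by simp
  finally show ?thesis .
qed

text \<open>For small nonzero \<open>q\<close> the geometric tail
  \<open>6 |q|^2 / (1 - 6 |q|)\<close> falls below \<open>|q|\<close> exactly when
  \<open>12 |q| < 1\<close>, whence the threshold.\<close>

lemma E2_deriv_series_minus_first_less:
  assumes "norm q < 1 / 12" "q \<noteq> 0"
  shows "norm (E2_deriv_series q - q) < norm q"
proof -
  have "norm (E2_deriv_series q - q) \<le> 6 * norm q ^ 2 / (1 - 6 * norm q)"
    using assms by (intro E2_deriv_series_minus_first_le) auto
  also have "\<dots> < norm q"
  proof -
    have "norm q * (12 * norm q) < norm q * 1"
      using assms by (intro mult_strict_left_mono) auto
    then show ?thesis
      using assms by (simp add: divide_simps) (simp add: power2_eq_square algebra_simps)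
  qed
  finally show ?thesis .
qed

lemma norm_E2_deriv_series_le:
  assumes "norm q < 1 / 12"
  shows "norm (E2_deriv_series q) \<le> 2 * norm q"
proof (cases "q = 0")
  case True
  have "E2_deriv_series 0 = (\<Sum>n. 0)"
    unfolding E2_deriv_series_def by (intro suminf_cong) (auto simp: power_0_left)
  then show ?thesis using True by simp
next
  case False
  have "norm (E2_deriv_series q) = norm ((E2_deriv_series q - q) + q)" by simp
  also have "\<dots> \<le> norm (E2_deriv_series q - q) + norm q"
    by (rule norm_triangle_ineq)
  finally show ?thesis
    using E2_deriv_series_minus_first_less[OF assms False] by linarith
qed

lemma E2_deriv_series_of_real:
  assumes "\<bar>x\<bar> < 1"
  shows "E2_deriv_series (of_real x) = of_real (\<Sum>n. real (n * sigma1 n) * x ^ n)"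
proof -
  have "summable (\<lambda>n. \<bar>real (n * sigma1 n) * x ^ n\<bar>)"
    using summable_n_sigma1[of "\<bar>x\<bar>"] assms by (simp add: abs_mult power_abs)
  then have "(\<lambda>n. real (n * sigma1 n) * x ^ n) sums (\<Sum>n. real (n * sigma1 n) * x ^ n)"
    by (rule summable_sums[OF summable_rabs_cancel])
  then have "(\<lambda>n. of_real (real (n * sigma1 n) * x ^ n) :: complex) sums of_real (\<Sum>n. real (n * sigma1 n) * x ^ n)"
    by (rule sums_of_real)
  then show ?thesis
    unfolding E2_deriv_series_def by (simp add: sums_iff)
qed

text \<open>\<open>sigma1 n <= n * sigma1 n\<close> majorizes the series by the derivative series at
  the real point \<open>norm (nome t)\<close>.\<close>

lemma norm_E2_minus_1_le:
  assumes t: "Im t > 0" and q: "norm (nome t) < 1 / 12"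
  shows "norm (E2 t - 1) \<le> 48 * norm (nome t)"
proof -
  let ?q = "norm (nome t)"
  have q1: "norm (nome t) < 1" using q by simp
  have s: "summable (\<lambda>n. real (n * sigma1 n) * ?q ^ n)"
    using q by (intro summable_n_sigma1) auto
  have "norm (\<Sum>n. of_nat (sigma1 n) * nome t ^ n) \<le> (\<Sum>n. norm (of_nat (sigma1 n) * nome t ^ n))"
    by (rule summable_norm[OF summable_norm_sigma1[OF q1]])
  also have "\<dots> \<le> (\<Sum>n. real (n * sigma1 n) * ?q ^ n)"
  proof (intro suminf_le summable_norm_sigma1 q1 s)
    fix n
    have "real (sigma1 n) \<le> real (n * sigma1 n)" by (cases n) auto
    then show "norm (of_nat (sigma1 n) * nome t ^ n) \<le> real (n * sigma1 n) * ?q ^ n"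
      unfolding norm_mult norm_of_nat norm_power by (intro mult_right_mono) auto
  qed
  also have "\<dots> \<le> norm (E2_deriv_series (of_real ?q))"
    using q by (subst E2_deriv_series_of_real) auto
  also have "\<dots> \<le> 2 * norm (of_real ?q :: complex)"
    using q by (intro norm_E2_deriv_series_le) auto
  finally show ?thesis
    by (simp add: E2_eq_powser[OF t] norm_mult)
qed

text \<open>Follows from \<open>exp (2 pi y) >= exp (6 y)\<close> and Taylor bounds for
  \<open>exp y\<close>. The linear factor leaves room for \<open>crit_nonzero_near_cusp\<close>,
  where \<open>q * (96 + 768 * Im t) < 2 / 3\<close> is needed with \<open>q\<close> the norm of the
  nome.\<close>

lemma norm_nome_le:
  assumes y: "Im t \<ge> 3 / 2"
  shows "norm (nome t) * (172 + 1392 * Im t) \<le> 1"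
proof -
  define y where "y = Im t"
  have y: "y \<ge> 3 / 2" using assms by (simp add: y_def)
  have e: "exp y \<ge> 1 + y + y ^ 2 / 2"
    using y by (intro exp_lower_Taylor_quadratic) auto
  have yy: "y ^ 2 \<ge> 3 / 2 * y"
    using y mult_right_mono[of "3 / 2" y y] by (simp add: power2_eq_square)
  have e1: "exp y \<ge> 1 + 7 / 4 * y" using e yy by simp
  have e2: "exp y \<ge> 29 / 8" using e1 y by simp
  have "172 + 1392 * y \<le> (29 / 8) ^ 4 * (1 + 7 / 4 * y) ^ 2"
  proof -
    have "172 + 1392 * y \<le> (29 / 8) ^ 4 * (1 + 7 / 2 * y + 49 / 16 * (3 / 2 * y))"
      using y by (simp add: power_numeral_reduce)
    also have "\<dots> \<le> (29 / 8) ^ 4 * (1 + 7 / 2 * y + 49 / 16 * y ^ 2)"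
      using yy by (intro mult_left_mono add_mono) auto
    also have "1 + 7 / 2 * y + 49 / 16 * y ^ 2 = (1 + 7 / 4 * y) ^ 2"
      by (simp add: power2_eq_square algebra_simps)
    finally show ?thesis .
  qed
  also have "\<dots> \<le> exp y ^ 4 * exp y ^ 2"
    using e1 e2 y by (intro mult_mono power_mono) auto
  also have "\<dots> = exp (6 * y)"
    by (simp flip: exp_of_nat_mult exp_add)
  also have "\<dots> \<le> exp (2 * pi * y)"
    using pi_gt3 y by simp
  finally have "172 + 1392 * y \<le> exp (2 * pi * y)" .
  then show ?thesis
    unfolding norm_nome y_def[symmetric] by (simp add: exp_minus field_simps)
qed

text \<open>High up, \<open>E2\<close> is close to 1 and \<open>E2'\<close> is exponentially small,
  so the middle term of \<open>crit\<close> outweighs the other two. The hypotheses on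
  \<open>K\<close> give \<open>norm (t - r) <= 2 * Im t\<close>, which controls the quadratic
  factor.\<close>

lemma crit_nonzero_near_cusp:
  assumes y: "Im t \<ge> 3 / 2" and K: "Im t \<ge> K" "norm (t - of_real r) \<le> Im t + K"
  shows "crit r t \<noteq> 0"
proof
  assume z: "crit r t = 0"
  define q where "q = norm (nome t)"
  define \<rho> where "\<rho> = norm (t - of_real r)"
  have t: "Im t > 0" using y by simp
  have q0: "q \<ge> 0" by (simp add: q_def)
  have qy: "q * (172 + 1392 * Im t) \<le> 1"
    unfolding q_def by (rule norm_nome_le[OF y])
  have "q * 2260 \<le> q * (172 + 1392 * Im t)"
    using y q0 by (intro mult_left_mono) auto
  then have q12: "q < 1 / 12" using qy by simp
  have \<rho>: "Im t \<le> \<rho>" "\<rho> \<le> 2 * Im t"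
    using K abs_Im_le_cmod[of "t - of_real r"] t by (auto simp: \<rho>_def)
  have E: "norm (E2 t) \<ge> 1 - 48 * q"
    using norm_triangle_ineq2[of 1 "1 - E2 t"] norm_E2_minus_1_le[OF t q12[unfolded q_def]]
    by (simp add: q_def norm_minus_commute)
  have D: "norm (deriv E2 t) \<le> 96 * pi * q"
    using norm_E2_deriv_series_le[OF q12[unfolded q_def]] mult_left_mono[of _ "2 * q" "48 * pi"]
    by (simp add: deriv_E2[OF t] norm_mult q_def)
  have "2 * (t - of_real r) * E2 t = - ((t - of_real r) ^ 2 * deriv E2 t) - 6 / (of_real pi * \<i>)"
    using z by (simp add: crit_def algebra_simps eq_neg_iff_add_eq_0)
  then have "norm (2 * (t - of_real r) * E2 t) \<le> norm ((t - of_real r) ^ 2 * deriv E2 t) + norm (6 / (of_real pi * \<i>))"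
    by (metis norm_minus_cancel norm_triangle_ineq4)
  then have le: "2 * \<rho> * norm (E2 t) \<le> \<rho> ^ 2 * norm (deriv E2 t) + 6 / pi"
    by (simp only: norm_mult norm_divide norm_power \<rho>_def) simp
  have \<rho>0: "\<rho> \<ge> 3 / 2" using \<rho> y by simp
  have "6 / pi \<le> 2" using pi_gt3 by (simp add: field_simps)
  also have "2 \<le> \<rho> * (4 / 3)" using \<rho>0 by simp
  finally have pi2: "6 / pi \<le> \<rho> * (4 / 3)" .
  have "2 * \<rho> * (1 - 48 * q) \<le> 2 * \<rho> * norm (E2 t)"
    using E \<rho>0 by (intro mult_left_mono) auto
  also note le
  also have "\<rho> ^ 2 * norm (deriv E2 t) \<le> \<rho> ^ 2 * (96 * pi * q)"
    using D by (intro mult_left_mono) auto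
  also have "\<rho> ^ 2 * (96 * pi * q) = \<rho> * (96 * pi * q * \<rho>)"
    by (simp add: power2_eq_square)
  also have "\<dots> \<le> \<rho> * (96 * 4 * q * (2 * Im t))"
    using \<rho> \<rho>0 q0 pi_less_4 by (intro mult_left_mono mult_mono) auto
  finally have "\<rho> * (2 * (1 - 48 * q)) \<le> \<rho> * (96 * 4 * q * (2 * Im t) + 4 / 3)"
    using pi2 by (simp add: algebra_simps)
  then have "2 * (1 - 48 * q) \<le> 96 * 4 * q * (2 * Im t) + 4 / 3"
    using \<rho>0 by (subst (asm) mult_le_cancel_left_pos) auto
  then have "2 / 3 \<le> q * (96 + 768 * Im t)"
    by (simp add: algebra_simps)
  moreover have "q * (96 + 768 * Im t) \<le> q * (2 / 3 * (172 + 1392 * Im t) - 10)"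
    using q0 t y by (intro mult_left_mono) auto
  moreover have "q * (2 / 3 * (172 + 1392 * Im t) - 10) = 2 / 3 * (q * (172 + 1392 * Im t)) - 10 * q"
    by (simp add: algebra_simps)
  moreover have "q > 0" by (simp add: q_def nome_def)
  ultimately show False using qy by linarith
qed

section \<open>Nonvanishing of \<open>E2'\<close> on \<open>F0\<close>\<close>

lemma deriv_E2_nonzero_small_nome:
  assumes "Im t > 0" "norm (nome t) < 1 / 12"
  shows "deriv E2 t \<noteq> 0"
proof -
  have "nome t \<noteq> 0" by (simp add: nome_def)
  then have "E2_deriv_series (nome t) \<noteq> 0"
    using E2_deriv_series_minus_first_less[OF assms(2)] by auto
  then show ?thesis using assms by (simp add: deriv_E2)
qed

lemma deriv_E2_minus_inverse:
  assumes "Im t > 0"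
  shows "deriv E2 (- 1 / t) = t ^ 2 * crit 0 t"
  using deriv_E2_moebius[of 0 0 "-1" 1 t] assms by simp

text \<open>Above height 9/20 the nome is below 1/12 and the first term of the series dominates.
  Below it the point is near the cusp 0, and inversion moves it to height at least 3/2, where
  \<open>crit 0\<close> does not vanish.\<close>

lemma deriv_E2_nonzero_F0_left:
  assumes t: "Im t > 0" "0 \<le> Re t" "Re t \<le> 1 / 2" "Re t \<le> Re t ^ 2 + Im t ^ 2"
  shows "deriv E2 t \<noteq> 0"
proof (cases "Im t \<ge> 9 / 20")
  case True
  have "exp (9 / 10 * 3 :: real) = exp (9 / 10) ^ 3"
    by (simp add: exp_of_nat_mult[symmetric])
  also have "\<dots> \<ge> (1 + 9 / 10 + (9 / 10) ^ 2 / 2) ^ 3"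
    by (intro power_mono exp_lower_Taylor_quadratic) auto
  finally have "12 < exp (9 / 10 * 3 :: real)"
    by (simp add: power_numeral_reduce)
  also have "\<dots> \<le> exp (2 * pi * Im t)"
    using mult_mono[of "9 / 20" "Im t" 6 "2 * pi"] pi_gt3 True by (simp add: mult_ac)
  finally have "norm (nome t) < 1 / 12"
    by (simp add: norm_nome exp_minus field_simps)
  with t show ?thesis by (intro deriv_E2_nonzero_small_nome)
next
  case False
  define x y where "x = Re t" and "y = Im t"
  have y: "0 < y" "y < 9 / 20" and x: "0 \<le> x" "x \<le> 1 / 2" "x \<le> x ^ 2 + y ^ 2"
    using t False by (auto simp: x_def y_def)
  have y2: "y ^ 2 \<le> 9 / 20 * y"
    using y by (simp add: power2_eq_square mult_right_mono)
  \<comment> \<open>The circle condition gives \<open>x * (1 - x) <= y ^ 2 < 81/400\<close>, while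
    \<open>x * (1 - x)\<close> is at least \<open>84/400\<close> between 3/10 and 1/2.\<close>
  have x310: "x \<le> 3 / 10"
  proof (rule ccontr)
    assume "\<not> x \<le> 3 / 10"
    then have "0 \<le> (x - 3 / 10) * (1 / 2 - x)" using x by (intro mult_nonneg_nonneg) auto
    then have "x ^ 2 \<le> 8 / 10 * x - 3 / 20"
      by (simp add: power2_eq_square field_simps)
    with x y2 y \<open>\<not> x \<le> 3 / 10\<close> show False by simp
  qed
  have "x ^ 2 \<le> 3 / 10 * x"
    using x mult_right_mono[OF x310, of x] by (simp add: power2_eq_square)
  then have nt: "x ^ 2 + y ^ 2 \<le> 9 / 14 * y"
    using x y2 by linarith
  define z where "z = - 1 / t"
  have n: "x ^ 2 + y ^ 2 > 0" using y by (intro add_nonneg_pos) auto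
  have t0: "t \<noteq> 0" using t by auto
  have Rez: "Re z = - x / (x ^ 2 + y ^ 2)" and Imz: "Im z = y / (x ^ 2 + y ^ 2)"
    by (simp_all add: z_def Re_divide Im_divide x_def y_def)
  have "Im z \<ge> 3 / 2"
    unfolding Imz using nt n y by (simp add: field_simps)
  have "\<bar>Re z\<bar> \<le> 1"
    unfolding Rez using x n by (simp add: abs_le_iff field_simps)
  have "norm z \<le> \<bar>Re z\<bar> + \<bar>Im z\<bar>" by (rule cmod_le)
  then have "crit 0 z \<noteq> 0"
    using \<open>Im z \<ge> 3 / 2\<close> \<open>\<bar>Re z\<bar> \<le> 1\<close> by (intro crit_nonzero_near_cusp[of _ 1]) auto
  moreover have "t = - 1 / z" using t0 by (simp add: z_def)
  moreover have "z \<noteq> 0" using t0 by (simp add: z_def)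
  ultimately show ?thesis
    using deriv_E2_minus_inverse[of z] \<open>Im z \<ge> 3 / 2\<close> by simp
qed

text \<open>The Fourier coefficients are real, so reflection in the imaginary axis conjugates the
  nome and the series.\<close>

lemma deriv_E2_uminus_cnj:
  assumes "Im t > 0"
  shows "deriv E2 (- cnj t) = - cnj (deriv E2 t)"
proof -
  have "nome (- cnj t) = cnj (nome t)"
    by (simp add: nome_def exp_cnj)
  moreover have "E2_deriv_series (cnj q) = cnj (E2_deriv_series q)" if "norm q < 1" for q
  proof -
    have "(\<lambda>n. of_nat (n * sigma1 n) * q ^ n) sums E2_deriv_series q"
      unfolding E2_deriv_series_def
      by (rule summable_sums[OF summable_norm_cancel[OF summable_norm_n_sigma1[OF that]]])
    then have "(\<lambda>n. cnj (of_nat (n * sigma1 n) * q ^ n)) sums cnj (E2_deriv_series q)"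
      by (simp only: sums_cnj)
    then show ?thesis
      unfolding E2_deriv_series_def[of "cnj q"] by (simp add: sums_iff)
  qed
  ultimately show ?thesis
    using assms by (simp add: deriv_E2 norm_nome_less_1)
qed

lemma deriv_E2_nonzero_F0:
  assumes "t \<in> F0"
  shows "deriv E2 t \<noteq> 0"
proof (cases "Re t \<le> 1 / 2")
  case True
  then show ?thesis
    using assms by (intro deriv_E2_nonzero_F0_left) (auto simp: mem_F0_iff)
next
  case False
  \<comment> \<open>Reflection in the line \<open>Re t = 1 / 2\<close>, which exchanges the two
    halves of \<open>F0\<close>.\<close>
  define s where "s = - cnj t + of_int 1"
  have t: "Im t > 0" "Re t \<le> 1" "Re t \<le> Re t ^ 2 + Im t ^ 2"
    using assms by (auto simp: mem_F0_iff)
  have "deriv E2 s \<noteq> 0"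
    using t False by (intro deriv_E2_nonzero_F0_left) (auto simp: s_def power2_eq_square algebra_simps)
  moreover have "deriv E2 s = - cnj (deriv E2 t)"
    unfolding s_def using t by (subst deriv_E2_add_of_int) (auto simp: deriv_E2_uminus_cnj)
  ultimately show ?thesis by auto
qed

section \<open>Zeros on special lines\<close>

text \<open>Meant for the lines \<open>Re t = 0\<close> and \<open>Re t = 1 / 2\<close>: real
  coefficients make \<open>E2\<close> real and \<open>E2'\<close> purely imaginary there.\<close>

lemma nome_real_imp_real:
  assumes t: "Im t > 0" and x: "nome t = of_real x"
  shows "E2 t = of_real (Re (E2 t))"
    and "deriv E2 t = - (48 * of_real pi * \<i> * of_real (\<Sum>n. real (n * sigma1 n) * x ^ n))"
proof -
  have x1: "\<bar>x\<bar> < 1"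
    using norm_nome_less_1[OF t] by (simp add: x)
  show "deriv E2 t = - (48 * of_real pi * \<i> * of_real (\<Sum>n. real (n * sigma1 n) * x ^ n))"
    unfolding deriv_E2[OF t] x E2_deriv_series_of_real[OF x1] by simp
  have "summable (\<lambda>n. of_nat (sigma1 n) * nome t ^ n)"
    by (rule summable_norm_cancel[OF summable_norm_sigma1[OF norm_nome_less_1[OF t]]])
  then have "(\<lambda>n. of_nat (sigma1 n) * of_real x ^ n :: complex) sums (\<Sum>n. of_nat (sigma1 n) * nome t ^ n)"
    unfolding x by (rule summable_sums)
  then have "(\<lambda>n. Im (of_nat (sigma1 n) * of_real x ^ n)) sums Im (\<Sum>n. of_nat (sigma1 n) * nome t ^ n)"
    by (rule sums_Im)
  moreover have "Im (of_nat (sigma1 n) * of_real x ^ n) = 0" for n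
    by (simp flip: of_real_power)
  ultimately have "Im (\<Sum>n. of_nat (sigma1 n) * nome t ^ n) = 0"
    by (simp add: sums_iff)
  then show "E2 t = of_real (Re (E2 t))"
    by (simp add: E2_eq_powser[OF t] complex_eq_iff)
qed

lemma E2_deriv_real_series_pos:
  fixes x :: real
  assumes "0 < x" "x < 1"
  shows "(\<Sum>n. real (n * sigma1 n) * x ^ n) > 0"
  using assms by (intro suminf_pos2[of _ 1] summable_n_sigma1) (auto simp: sigma1_1)

lemma nome_imaginary: "nome (\<i> * of_real y) = of_real (exp (- 2 * pi * y))"
proof -
  have "2 * of_real pi * \<i> * (\<i> * of_real y) = of_real (- 2 * pi * y)"
    by (simp add: complex_eq_iff)
  then show ?thesis unfolding nome_def by (simp only: exp_of_real)
qed

lemma deriv_E2_imaginary_nonzero: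
  assumes "y > 0"
  shows "deriv E2 (\<i> * of_real y) \<noteq> 0"
  using nome_real_imp_real(2)[OF _ nome_imaginary, of y] assms
    E2_deriv_real_series_pos[of "exp (- 2 * pi * y)"] by auto

text \<open>For \<open>r = 0\<close> inversion reduces to \<open>E2'\<close>, whose series has a
  positive sum on the imaginary axis. Otherwise a zero of the real part forces
  \<open>e = - S * y\<close>, and then the imaginary part is
  \<open>- S * (r^2 + y^2) - 6 / pi < 0\<close>.\<close>

lemma crit_imaginary_nonzero:
  assumes y: "y > 0"
  shows "crit r (\<i> * of_real y) \<noteq> 0"
proof (cases "r = 0")
  case True
  have "deriv E2 (\<i> * of_real (1 / y)) \<noteq> 0"
    using y by (intro deriv_E2_imaginary_nonzero) auto
  moreover have "- 1 / (\<i> * of_real y) = \<i> * of_real (1 / y)"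
    using y by (simp add: field_simps)
  ultimately show ?thesis
    using deriv_E2_minus_inverse[of "\<i> * of_real y"] y True by auto
next
  case False
  define t where "t = \<i> * of_real y"
  define e where "e = Re (E2 t)"
  define S where "S = 48 * pi * (\<Sum>n. real (n * sigma1 n) * exp (- 2 * pi * y) ^ n)"
  have t: "Im t > 0" using y by (simp add: t_def)
  have "S > 0"
    unfolding S_def using E2_deriv_real_series_pos[of "exp (- 2 * pi * y)"] y by simp
  have E: "E2 t = of_real e" and D: "deriv E2 t = - (\<i> * of_real S)"
    using nome_real_imp_real[OF t nome_imaginary[of y, folded t_def]] by (simp_all add: e_def S_def mult_ac)
  have \<kappa>: "6 / (of_real pi * \<i>) = - (\<i> * of_real (6 / pi))"
    by (simp add: field_simps)
  have crit: "crit r t = (t - of_real r) ^ 2 * - (\<i> * of_real S) + 2 * (t - of_real r) * of_real e - \<i> * of_real (6 / pi)"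
    unfolding crit_def E D \<kappa> by simp
  have Re: "Re (crit r t) = - 2 * r * (S * y + e)"
    and Im: "Im (crit r t) = - S * (r ^ 2 - y ^ 2) + 2 * y * e - 6 / pi"
    unfolding crit by (simp_all add: t_def power2_eq_square algebra_simps)
  show ?thesis
  proof
    assume "crit r (\<i> * of_real y) = 0"
    then have z: "crit r t = 0" by (simp add: t_def)
    then have "e = - S * y" using Re False by (simp add: eq_neg_iff_add_eq_0 add.commute)
    then have "0 = - S * (r ^ 2 + y ^ 2) - 6 / pi"
      using Im z by (simp add: power2_eq_square algebra_simps)
    moreover have "S * (r ^ 2 + y ^ 2) \<ge> 0" using \<open>S > 0\<close> by simp
    moreover have "6 / pi > 0" by simp
    ultimately show False by linarith
  qed
qed

section \<open>Location of the zeros of \<open>crit r\<close> in \<open>F0\<close>\<close>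

lemma crit_nonzero_Re_0_or_1:
  assumes "Im t > 0" "Re t = 0 \<or> Re t = 1"
  shows "crit r t \<noteq> 0"
  using assms(2)
proof
  assume "Re t = 0"
  then have "t = \<i> * of_real (Im t)" by (simp add: complex_eq_iff)
  then show ?thesis using crit_imaginary_nonzero[OF assms(1)] by metis
next
  assume "Re t = 1"
  then have "t = \<i> * of_real (Im t) + of_int 1" by (simp add: complex_eq_iff)
  then have "crit r t = crit (r - of_int 1) (\<i> * of_real (Im t))"
    using crit_add_of_int[of "\<i> * of_real (Im t)" r 1] assms by simp
  then show ?thesis using crit_imaginary_nonzero[OF assms(1)] by simp
qed

lemma crit_rotate_eq_0_iff:
  assumes "Im t > 0" "r \<noteq> 1"
  shows "crit (1 / (1 - r)) (1 / (1 - t)) = 0 \<longleftrightarrow> crit r t = 0"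
proof -
  have "1 - t \<noteq> 0" "1 - of_real r \<noteq> (0::complex)"
    using assms by (auto simp: complex_eq_iff)
  then show ?thesis unfolding crit_rotate[OF assms] by simp
qed

text \<open>The vertical sides are excluded directly; the order three map carries the bounding
  semicircle to the line \<open>Re = 1\<close>.\<close>

lemma crit_zero_in_interior:
  assumes t: "t \<in> F0" and z: "crit r t = 0" and r: "r \<noteq> 1"
  shows "0 < Re t" "Re t < 1" "Re t < Re t ^ 2 + Im t ^ 2"
proof -
  have t': "Im t > 0" "0 \<le> Re t" "Re t \<le> 1" "Re t \<le> Re t ^ 2 + Im t ^ 2"
    using t by (auto simp: mem_F0_iff)
  show "0 < Re t" "Re t < 1"
    using crit_nonzero_Re_0_or_1[of t r] t' z by force+
  show "Re t < Re t ^ 2 + Im t ^ 2"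
  proof (rule ccontr)
    assume "\<not> ?thesis"
    then have "(1 - Re t) ^ 2 + Im t ^ 2 = 1 - Re t"
      using t' by (simp add: power2_eq_square algebra_simps)
    then have "Re (1 / (1 - t)) = 1"
      unfolding Re_Im_rotate using \<open>Re t < 1\<close> by simp
    then have "crit (1 / (1 - r)) (1 / (1 - t)) \<noteq> 0"
      using Im_rotate_pos[OF t'(1)] by (intro crit_nonzero_Re_0_or_1) auto
    then show False using crit_rotate_eq_0_iff[OF t'(1) r] z by simp
  qed
qed

lemma crit_zero_Im_le:
  assumes t: "t \<in> F0" "crit r t = 0" and K: "K \<ge> 3 / 2" "\<And>x. 0 \<le> x \<Longrightarrow> x \<le> 1 \<Longrightarrow> \<bar>x - r\<bar> \<le> K"
  shows "Im t \<le> K"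
proof (rule ccontr)
  assume "\<not> Im t \<le> K"
  moreover have "norm (t - of_real r) \<le> \<bar>Re t - r\<bar> + Im t"
    using cmod_le[of "t - of_real r"] t by (simp add: mem_F0_iff)
  moreover have "\<bar>Re t - r\<bar> \<le> K"
    using t by (intro K) (auto simp: mem_F0_iff)
  ultimately have "crit r t \<noteq> 0"
    using K(1) by (intro crit_nonzero_near_cusp[of _ K]) auto
  with t show False by simp
qed

text \<open>The height bound is applied at all three cusps: to \<open>t\<close> and to its images
  \<open>s\<close> and \<open>w\<close> under the order three map, with parameters
  \<open>1 / (1 - r)\<close> and \<open>1 - 1 / r\<close>. Bounded heights of the images keep
  \<open>t\<close> away from the cusps 1 and 0, with one \<open>K\<close> for all \<open>r\<close>
  in a compact part of the unit interval.\<close>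

lemma crit_zero_Im_bounds:
  assumes t: "t \<in> F0" and z: "crit r t = 0" and r: "0 < r" "r < 1"
    and K: "K \<ge> 3 / 2" "1 / r \<le> K" "1 / (1 - r) \<le> K"
  shows "1 / (2 * K) \<le> Im t" "Im t \<le> K"
proof -
  define x y where "x = Re t" and "y = Im t"
  have xy: "y > 0" "0 \<le> x" "x \<le> 1" "x \<le> x ^ 2 + y ^ 2"
    using t by (auto simp: mem_F0_iff x_def y_def)
  show "Im t \<le> K"
    by (rule crit_zero_Im_le[OF t z]) (use r K in auto)
  define s where "s = 1 / (1 - t)"
  have s: "s \<in> F0" "Im s > 0" unfolding s_def using F0_rotate[OF t] by (auto simp: mem_F0_iff)
  have zs: "crit (1 / (1 - r)) s = 0"
    unfolding s_def using crit_rotate_eq_0_iff[of t r] xy r z by (simp add: y_def)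
  have "1 / (1 - r) \<ge> 1" using r by simp
  have "Im s \<le> K"
    by (rule crit_zero_Im_le[OF s(1) zs]) (use K \<open>1 / (1 - r) \<ge> 1\<close> in auto)
  moreover have "Im s = y / ((1 - x) ^ 2 + y ^ 2)"
    by (simp only: s_def Re_Im_rotate x_def y_def)
  moreover have "(1 - x) ^ 2 + y ^ 2 > 0" using xy by (intro add_nonneg_pos) auto
  ultimately have 1: "y \<le> K * ((1 - x) ^ 2 + y ^ 2)"
    by (simp add: field_simps)
  define w where "w = 1 / (1 - s)"
  have w: "w \<in> F0" unfolding w_def by (rule F0_rotate[OF s(1)])
  have zw: "crit (1 - 1 / r) w = 0"
  proof -
    have "1 / (1 - 1 / (1 - r)) = 1 - 1 / r" using r by (simp add: field_simps)
    moreover have "1 / (1 - r) \<noteq> 1" using r by simp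
    ultimately show ?thesis
      unfolding w_def using crit_rotate_eq_0_iff[OF s(2), of "1 / (1 - r)"] zs by simp
  qed
  have "1 / r \<ge> 1" using r by simp
  have "Im w \<le> K"
    by (rule crit_zero_Im_le[OF w zw]) (use K \<open>1 / r \<ge> 1\<close> in auto)
  moreover have "w = 1 - 1 / t"
  proof -
    have nz: "1 - t \<noteq> 0" "t \<noteq> 0" using xy by (auto simp: complex_eq_iff y_def)
    have "1 - 1 / (1 - t) = - t / (1 - t)" using nz by (simp add: field_simps)
    then have "w = (1 - t) / - t" by (simp add: w_def s_def)
    then show ?thesis using nz by (simp add: field_simps)
  qed
  then have "Im w = y / (x ^ 2 + y ^ 2)"
    by (simp add: Im_divide x_def y_def)
  moreover have "x ^ 2 + y ^ 2 > 0" using xy by (intro add_nonneg_pos) auto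
  ultimately have 2: "y \<le> K * (x ^ 2 + y ^ 2)"
    by (simp add: field_simps)
  \<comment> \<open>\<open>u\<close> is the horizontal distance to the nearer of the cusps 0 and 1,
    up to sign; as it is at most 1/2, the circle condition gives
    \<open>u^2 <= u - u^2 <= y^2\<close>.\<close>
  have "\<exists>u. u ^ 2 \<le> y ^ 2 \<and> y \<le> K * (u ^ 2 + y ^ 2)"
  proof (cases "x \<le> 1 / 2")
    case True
    have "x ^ 2 \<le> 1 / 2 * x" using mult_right_mono[OF True, of x] xy by (simp add: power2_eq_square)
    then have "x ^ 2 \<le> y ^ 2" using xy by linarith
    then show ?thesis using 2 by blast
  next
    case False
    define A where "A = (1 - x) ^ 2"
    have "A \<le> 1 / 2 * (1 - x)"
      unfolding A_def using mult_right_mono[of "1 - x" "1 / 2" "1 - x"] False xy by (simp add: power2_eq_square)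
    moreover have "A = 1 - 2 * x + x ^ 2" by (simp add: A_def power2_eq_square algebra_simps)
    moreover have "x - x ^ 2 \<le> y ^ 2" using xy by simp
    ultimately have "A \<le> y ^ 2" by (simp add: field_simps)
    then show ?thesis using 1 unfolding A_def by blast
  qed
  then obtain u where u: "u ^ 2 \<le> y ^ 2" "y \<le> K * (u ^ 2 + y ^ 2)" by blast
  have "y \<le> K * (y ^ 2 + y ^ 2)"
    using u K by (elim order.trans) (intro mult_left_mono, auto)
  then have "y * 1 \<le> y * (2 * K * y)" by (simp add: power2_eq_square algebra_simps)
  then have "1 \<le> 2 * K * y" using xy by (subst (asm) mult_le_cancel_left_pos) auto
  then show "1 / (2 * K) \<le> Im t"
    using K by (simp add: field_simps y_def)
qed

text \<open>The point is fixed by an elliptic element of \<open>Gamma0 2\<close> whose factor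
  \<open>2 t - 1 = i\<close> squares to -1, so the transformation law becomes a linear equation for
  \<open>E2 t\<close>.\<close>

lemma E2_elliptic_point: "E2 ((1 + \<i>) / 2) = of_real (6 / pi)"
proof -
  define t where "t = (1 + \<i>) / 2"
  have t: "Im t > 0" by (simp add: t_def)
  have j: "2 * t - 1 = \<i>" by (simp add: t_def complex_eq_iff)
  have "(t - 1) / (2 * t - 1) = t"
    unfolding j by (simp add: t_def field_simps)
  then have "E2 t = (2 * t - 1) ^ 2 * E2 t + 6 / (of_real pi * \<i>) * 2 * (2 * t - 1)"
    using E2_moebius[of 1 "-1" "-1" 2 t] t by simp
  then have "E2 t = - E2 t + 12 / of_real pi"
    unfolding j by simp
  then have "2 * E2 t = 2 * (6 / of_real pi)" by (simp add: eq_neg_iff_add_eq_0)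
  then have "E2 t = 6 / of_real pi" by (subst (asm) mult_left_cancel) auto
  then show ?thesis unfolding t_def by simp
qed

lemma nome_half_plus_imaginary: "nome (1 / 2 + \<i> * of_real y) = of_real (- exp (- 2 * pi * y))"
proof -
  have "nome (1 / 2 + \<i> * of_real y) = exp (of_real pi * \<i>) * nome (\<i> * of_real y)"
    by (simp add: nome_def ring_distribs exp_add)
  then show ?thesis by (simp add: nome_imaginary)
qed

text \<open>On the symmetry line \<open>Re t = 1 / 2\<close> the nome is real and
  \<open>crit (1 / 2)\<close> is purely imaginary, so a sign change between heights 1/2 and 2
  suffices.\<close>

lemma crit_half_zero_exists: "\<exists>t\<in>F0. crit (1 / 2) t = 0"
proof -
  define T where "T = (\<lambda>y. 1 / 2 + \<i> * of_real y)"
  have ImT: "Im (T y) = y" for y by (simp add: T_def)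
  define S where "S = (\<lambda>y. Re (E2_deriv_series (nome (T y))))"
  have TS: "T y - of_real (1 / 2) = \<i> * of_real y" for y by (simp add: T_def)
  have \<kappa>: "6 / (of_real pi * \<i>) = - (\<i> * of_real (6 / pi))"
    by (simp add: field_simps)
  have crit: "crit (1 / 2) (T y) = \<i> * of_real (48 * pi * y ^ 2 * S y + 2 * y * Re (E2 (T y)) - 6 / pi)"
    if "y > 0" for y
  proof -
    have Ty: "Im (T y) > 0" using that by (simp add: ImT)
    have n: "nome (T y) = of_real (- exp (- 2 * pi * y))"
      unfolding T_def by (rule nome_half_plus_imaginary)
    have "E2_deriv_series (nome (T y)) = of_real (S y)"
      unfolding S_def n using that by (subst (1 2) E2_deriv_series_of_real) auto
    then have D: "deriv E2 (T y) = - (48 * of_real pi * \<i> * of_real (S y))"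
      by (simp add: deriv_E2[OF Ty])
    show ?thesis
      unfolding crit_def TS D \<kappa> nome_real_imp_real(1)[OF Ty n, symmetric]
      by (subst nome_real_imp_real(1)[OF Ty n]) (simp add: power2_eq_square algebra_simps)
  qed
  have "continuous_on {1 / 2..2} (\<lambda>y. Im (crit (1 / 2) (T y)))"
  proof -
    have T: "continuous_on {1 / 2..2} T" unfolding T_def by (intro continuous_intros)
    have sub: "T ` {1 / 2..2} \<subseteq> {z. Im z > 0}" by (auto simp: ImT)
    show ?thesis
      unfolding crit_def
      by (intro continuous_intros T continuous_on_compose2[OF holomorphic_on_imp_continuous_on[OF holomorphic_E2] T sub]
          continuous_on_compose2[OF holomorphic_on_imp_continuous_on[OF holomorphic_deriv_E2] T sub])
  qed
  \<comment> \<open>At the elliptic point \<open>2 * y * E2\<close> cancels \<open>6 / pi\<close>,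
    leaving the sign of \<open>S\<close>, which is that of its leading term, the negative
    nome.\<close>
  moreover have "Im (crit (1 / 2) (T (1 / 2))) \<le> 0"
  proof -
    have T: "T (1 / 2) = (1 + \<i>) / 2" by (simp add: T_def field_simps)
    have q: "nome (T (1 / 2)) = of_real (- exp (- pi))"
      using nome_half_plus_imaginary[of "1 / 2"] by (simp add: T_def)
    have "12 < (1 + (3 / 2) + (3 / 2) ^ 2 / 2 :: real) ^ 2" by (simp add: power2_eq_square)
    also have "\<dots> \<le> exp (3 / 2) ^ 2"
      by (intro power_mono exp_lower_Taylor_quadratic) auto
    also have "\<dots> = exp (3 :: real)" by (simp add: exp_of_nat_mult[symmetric])
    also have "\<dots> \<le> exp pi" using pi_gt3 by simp
    finally have "norm (nome (T (1 / 2))) < 1 / 12"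
      by (simp only: norm_nome ImT) (simp add: exp_minus field_simps)
    then have "norm (E2_deriv_series (nome (T (1 / 2))) - nome (T (1 / 2))) < norm (nome (T (1 / 2)))"
      by (rule E2_deriv_series_minus_first_less) (simp add: nome_def)
    then have "\<bar>S (1 / 2) + exp (- pi)\<bar> < exp (- pi)"
      using abs_Re_le_cmod[of "E2_deriv_series (nome (T (1 / 2))) - nome (T (1 / 2))"]
      by (simp add: S_def q)
    then have "S (1 / 2) < 0" by linarith
    then show ?thesis
      using crit[of "1 / 2"] E2_elliptic_point by (simp add: T mult_nonneg_nonpos)
  qed
  \<comment> \<open>At height 2 the nome is tiny and the value is close to
    \<open>8 / 2 - 6 / pi\<close>.\<close>
  moreover have "Im (crit (1 / 2) (T 2)) \<ge> 0"
  proof -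
    have T2: "Im (T 2) > 0" "Im (T 2) \<ge> 3 / 2" by (simp_all add: ImT)
    define q where "q = norm (nome (T 2))"
    have q: "q * 2956 \<le> 1" using norm_nome_le[OF T2(2)] by (simp add: q_def ImT)
    then have q12: "norm (nome (T 2)) < 1 / 12" by (simp add: q_def)
    have "\<bar>Re (E2 (T 2) - 1)\<bar> \<le> 48 * q"
      using norm_E2_minus_1_le[OF T2(1) q12] abs_Re_le_cmod[of "E2 (T 2) - 1"] by (simp add: q_def)
    then have "Re (E2 (T 2)) \<ge> 1 - 48 * q" by simp
    moreover have "\<bar>S 2\<bar> \<le> 2 * q"
      using norm_E2_deriv_series_le[OF q12] abs_Re_le_cmod[of "E2_deriv_series (nome (T 2))"]
      by (simp add: S_def q_def)
    then have "192 * pi * \<bar>S 2\<bar> \<le> 192 * 4 * (2 * q)"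
      using pi_less_4 by (intro mult_mono) auto
    then have "\<bar>192 * pi * S 2\<bar> \<le> 192 * 4 * (2 * q)"
      by (simp add: abs_mult)
    moreover have "6 / pi \<le> 2" using pi_gt3 by (simp add: field_simps)
    ultimately have "48 * pi * 2 ^ 2 * S 2 + 2 * 2 * Re (E2 (T 2)) - 6 / pi \<ge> 0"
      using q by (simp add: abs_le_iff)
    then show ?thesis using crit[of 2] by simp
  qed
  ultimately obtain y where y: "1 / 2 \<le> y" "y \<le> 2" "Im (crit (1 / 2) (T y)) = 0"
    using IVT'[of "\<lambda>y. Im (crit (1 / 2) (T y))" "1 / 2" 0 2] by auto
  have "crit (1 / 2) (T y) = 0"
    using crit[of y] y by (simp add: complex_eq_iff)
  moreover have "T y \<in> F0"
  proof -
    have "y ^ 2 \<ge> (1 / 2) ^ 2" using y by (intro power_mono) auto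
    then show ?thesis using y by (simp add: mem_F0_iff T_def power2_eq_square)
  qed
  ultimately show ?thesis by blast
qed

section \<open>Existence of critical points\<close>

lemma holomorphic_crit: "crit r holomorphic_on {z. Im z > 0}"
  unfolding crit_def[abs_def] by (intro holomorphic_intros holomorphic_E2 holomorphic_deriv_E2)

text \<open>Constancy around a zero would spread by analytic continuation to the point
  \<open>i\<close>, but \<open>crit\<close> has no zero on the imaginary axis.\<close>

lemma crit_not_constant_on_ball:
  assumes e: "e > 0" "ball t e \<subseteq> {z. Im z > 0}" and z: "crit r t = 0"
  shows "\<not> crit r constant_on ball t e"
proof
  assume "crit r constant_on ball t e"
  then have zero: "crit r s = 0" if "s \<in> ball t e" for s
    using that z e by (auto simp: constant_on_def)
  have "crit r \<i> = 0"
    by (rule analytic_continuation_open[OF open_ball open_Im_gt_0 _ _ e(2) holomorphic_crit holomorphic_on_const])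
      (use e zero in \<open>auto simp: convex_connected convex_halfspace_Im_gt\<close>)
  then show False
    using crit_imaginary_nonzero[of 1 r] by simp
qed

text \<open>\<open>crit r\<close> is a polynomial in \<open>r\<close> whose coefficients are
  continuous, hence bounded on compact sets.\<close>

lemma uniform_limit_crit:
  assumes r: "r \<longlonglongrightarrow> r0" and K: "compact K" "K \<subseteq> {z. Im z > 0}"
  shows "uniform_limit K (\<lambda>n. crit (r n)) (crit r0) sequentially"
proof -
  have lim: "uniform_limit K (\<lambda>n t. t - of_real (r n)) (\<lambda>t. t - of_real r0) sequentially"
  proof (rule uniform_limitI)
    fix \<epsilon> :: real
    assume "\<epsilon> > 0"
    with r have "eventually (\<lambda>n. dist (r n) r0 < \<epsilon>) sequentially"
      by (rule tendstoD)
    then show "\<forall>\<^sub>F n in sequentially. \<forall>t\<in>K. dist (t - of_real (r n)) (t - of_real r0) < \<epsilon>"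
      by eventually_elim (simp add: dist_norm abs_minus_commute flip: of_real_diff)
  qed
  have bdd: "bounded (f ` K)" if "continuous_on K f" for f :: "complex \<Rightarrow> complex"
    using that K by (intro compact_imp_bounded compact_continuous_image)
  have E: "continuous_on K E2" and D: "continuous_on K (deriv E2)"
    using K(2) holomorphic_E2 holomorphic_deriv_E2
    by (auto intro: continuous_on_subset holomorphic_on_imp_continuous_on)
  have "uniform_limit K (\<lambda>n t. (t - of_real (r n)) * (t - of_real (r n)) * deriv E2 t +
        2 * (t - of_real (r n)) * E2 t + 6 / (of_real pi * \<i>))
      (\<lambda>t. (t - of_real r0) * (t - of_real r0) * deriv E2 t +
        2 * (t - of_real r0) * E2 t + 6 / (of_real pi * \<i>)) sequentially"
    by (intro uniform_limit_add uniform_lim_mult lim uniform_limit_const bdd continuous_intros E D)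
  then show ?thesis
    unfolding crit_def[abs_def] power2_eq_square .
qed

text \<open>Zeros persist under small changes of \<open>r\<close> by Hurwitz' theorem, since they lie in the interior of \<open>F0\<close>.\<close>

lemma crit_zero_persists:
  assumes t: "t \<in> F0" "crit r0 t = 0" and r0: "r0 \<noteq> 1"
  shows "\<exists>e>0. \<forall>r. \<bar>r - r0\<bar> < e \<longrightarrow> (\<exists>t\<in>F0. crit r t = 0)"
proof (rule ccontr)
  assume "\<not> ?thesis"
  then have "\<forall>n. \<exists>r. \<bar>r - r0\<bar> < 1 / real (Suc n) \<and> (\<forall>t\<in>F0. crit r t \<noteq> 0)"
    by (metis divide_pos_pos of_nat_0_less_iff zero_less_Suc zero_less_one)
  then obtain r where r: "\<And>n. \<bar>r n - r0\<bar> < 1 / real (Suc n)" "\<And>n t. t \<in> F0 \<Longrightarrow> crit (r n) t \<noteq> 0"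
    by metis
  have "(\<lambda>n. r n - r0) \<longlonglongrightarrow> 0"
    by (rule Lim_null_comparison[OF _ LIMSEQ_inverse_real_of_nat])
      (use r(1) in \<open>auto simp: inverse_eq_divide intro!: always_eventually less_imp_le\<close>)
  then have lim: "r \<longlonglongrightarrow> r0"
    by (simp add: LIM_zero_iff)
  define U where "U = {t. Im t > 0 \<and> 0 < Re t \<and> Re t < 1 \<and> Re t < Re t ^ 2 + Im t ^ 2}"
  have "open U"
    unfolding U_def by (intro open_Collect_conj open_Collect_less continuous_intros)
  moreover have "t \<in> U"
    using crit_zero_in_interior[OF t r0] t(1) by (simp add: U_def mem_F0_iff)
  ultimately obtain e where e: "e > 0" "ball t e \<subseteq> U"
    by (meson open_contains_ball)
  have sub: "ball t e \<subseteq> F0" "ball t e \<subseteq> {z. Im z > 0}"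
    using e(2) by (auto simp: U_def mem_F0_iff)
  have "crit r0 t \<noteq> 0"
  proof (rule Hurwitz_no_zeros[of "ball t e" "\<lambda>n. crit (r n)" "crit r0" t])
    show "crit (r n) holomorphic_on ball t e" for n
      using holomorphic_crit sub(2) by (rule holomorphic_on_subset)
    show "crit r0 holomorphic_on ball t e"
      using holomorphic_crit sub(2) by (rule holomorphic_on_subset)
    show "uniform_limit K (\<lambda>n. crit (r n)) (crit r0) sequentially" if "compact K" "K \<subseteq> ball t e" for K
      using that sub by (intro uniform_limit_crit lim) auto
    show "\<not> crit r0 constant_on ball t e"
      by (rule crit_not_constant_on_ball[OF e(1) sub(2) t(2)])
    show "crit (r n) s \<noteq> 0" if "s \<in> ball t e" for n s
      using that sub r(2) by auto
  qed (use e in auto)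
  with t show False by simp
qed

text \<open>The height bounds hold uniformly for parameters in \<open>{a..b}\<close>, so the zeros
  stay in a compact subset of the half plane; a limit point lies in \<open>F0\<close> and is a zero
  by continuity.\<close>

lemma crit_zero_limit:
  assumes r: "r \<longlonglongrightarrow> r0" and ab: "0 < a" "b < 1" "\<And>n. r n \<in> {a..b}"
    and z: "\<And>n. \<exists>t\<in>F0. crit (r n) t = 0"
  shows "\<exists>t\<in>F0. crit r0 t = 0"
proof -
  obtain t where t: "\<And>n. t n \<in> F0" "\<And>n. crit (r n) (t n) = 0"
    using z by metis
  define K where "K = max (3 / 2) (max (1 / a) (1 / (1 - b)))"
  define C where "C = cbox (Complex 0 (1 / (2 * K))) (Complex 1 K) \<inter> {t. Re t \<le> Re t ^ 2 + Im t ^ 2}"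
  have K: "K \<ge> 3 / 2" by (simp add: K_def)
  have "compact C"
    unfolding C_def by (intro compact_Int_closed compact_cbox closed_Collect_le continuous_intros)
  have "t n \<in> C" for n
  proof -
    have rn: "0 < r n" "r n < 1" using ab(1,2) ab(3)[of n] by auto
    have "1 / r n \<le> 1 / a" "1 / (1 - r n) \<le> 1 / (1 - b)"
      using ab(1,2) ab(3)[of n] by (auto intro!: divide_left_mono)
    then have "1 / (2 * K) \<le> Im (t n)" "Im (t n) \<le> K"
      by (auto intro!: crit_zero_Im_bounds[OF t rn] simp: K_def)
    then show ?thesis
      using t(1)[of n] by (auto simp: C_def in_cbox_complex_iff mem_F0_iff)
  qed
  then obtain l \<phi> where l: "l \<in> C" "strict_mono \<phi>" "(t \<circ> \<phi>) \<longlonglongrightarrow> l"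
    using \<open>compact C\<close> unfolding compact_def by metis
  have "0 < 1 / (2 * K)" using K by simp
  also have "\<dots> \<le> Im l" using l(1) by (simp add: C_def in_cbox_complex_iff)
  finally have "l \<in> F0" using l(1) by (auto simp: C_def in_cbox_complex_iff mem_F0_iff)
  then have Im: "Im l > 0" by (simp add: mem_F0_iff)
  have cont: "isCont E2 l" "isCont (deriv E2) l"
    using holomorphic_on_imp_continuous_on[OF holomorphic_E2] holomorphic_on_imp_continuous_on[OF holomorphic_deriv_E2] Im
    by (auto simp: continuous_on_eq_continuous_at[OF open_Im_gt_0])
  have t\<phi>: "(\<lambda>n. t (\<phi> n)) \<longlonglongrightarrow> l" using l(3) by (simp add: o_def)
  have r\<phi>: "(\<lambda>n. r (\<phi> n)) \<longlonglongrightarrow> r0" using LIMSEQ_subseq_LIMSEQ[OF r l(2)] by (simp add: o_def)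
  have "(\<lambda>n. crit (r (\<phi> n)) (t (\<phi> n))) \<longlonglongrightarrow> crit r0 l"
    unfolding crit_def
    by (intro tendsto_intros t\<phi> r\<phi> isCont_tendsto_compose[OF cont(1)] isCont_tendsto_compose[OF cont(2)])
  moreover have "(\<lambda>n. crit (r (\<phi> n)) (t (\<phi> n))) = (\<lambda>n. 0)" using t(2) by simp
  ultimately have "crit r0 l = 0" by (simp add: LIMSEQ_const_iff)
  with \<open>l \<in> F0\<close> show ?thesis by blast
qed

text \<open>Connectedness of a compact interval containing both \<open>r\<close> and
  \<open>1 / 2\<close> and avoiding the parameters 0 and 1.\<close>

lemma crit_zero_exists_unit_interval:
  assumes r: "0 < r" "r < 1"
  shows "\<exists>t\<in>F0. crit r t = 0"
proof -
  define a b where "a = min r (1 / 2)" and "b = max r (1 / 2)"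
  have ab: "0 < a" "b < 1" using r by (auto simp: a_def b_def)
  define Z where "Z = {r \<in> {a..b}. \<exists>t\<in>F0. crit r t = 0}"
  have "openin (top_of_set {a..b}) Z"
    unfolding openin_euclidean_subtopology_iff
  proof (intro conjI ballI)
    fix x assume x: "x \<in> Z"
    then obtain t where "t \<in> F0" "crit x t = 0" "x \<noteq> 1"
      using ab by (auto simp: Z_def)
    from crit_zero_persists[OF this] show "\<exists>e>0. \<forall>x'\<in>{a..b}. dist x' x < e \<longrightarrow> x' \<in> Z"
      by (auto simp: Z_def dist_real_def)
  qed (auto simp: Z_def)
  moreover have "closedin (top_of_set {a..b}) Z"
  proof (rule closed_subset)
    show "closed Z"
      unfolding closed_sequential_limits
    proof (intro allI impI, elim conjE)
      fix x l assume x: "\<forall>n. x n \<in> Z" and l: "x \<longlonglongrightarrow> l"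
      have "l \<in> {a..b}"
        using closed_sequentially[OF closed_atLeastAtMost _ l] x by (auto simp: Z_def)
      moreover have "\<exists>t\<in>F0. crit l t = 0"
        by (rule crit_zero_limit[OF l ab]) (use x in \<open>auto simp: Z_def\<close>)
      ultimately show "l \<in> Z" by (simp add: Z_def)
    qed
  qed (auto simp: Z_def)
  ultimately have "Z = {} \<or> Z = {a..b}"
    using connected_clopen[of "{a..b}"] connected_Icc[of a b] by blast
  moreover have "1 / 2 \<in> Z"
    using crit_half_zero_exists by (auto simp: Z_def a_def b_def)
  ultimately have "r \<in> Z"
    by (auto simp: a_def b_def)
  then show ?thesis by (simp add: Z_def)
qed

text \<open>One step of \<open>r -> 1 / (1 - r)\<close> takes negative \<open>r\<close> into the
  unit interval and \<open>r > 1\<close> to negative values.\<close>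

lemma crit_zero_exists:
  assumes "r \<noteq> 0" "r \<noteq> 1"
  shows "\<exists>t\<in>F0. crit r t = 0"
proof -
  have neg: "\<exists>t\<in>F0. crit r t = 0" if "r < 0" for r
    by (rule crit_zero_rotate) (use that in \<open>auto intro!: crit_zero_exists_unit_interval\<close>)
  consider "r < 0" | "0 < r" "r < 1" | "r > 1" using assms by linarith
  then show ?thesis
  proof cases
    case 3
    then have "1 / (1 - r) < 0" by simp
    with 3 show ?thesis using crit_zero_rotate[OF assms(2) neg] by simp
  qed (use neg crit_zero_exists_unit_interval in auto)
qed

unbundle no fps_syntax

theorem theorem1p2:
  fixes \<gamma> :: "int ^ 2 ^ 2" and F :: "complex set"
  assumes "\<gamma> \<in> Gamma0 2"
    and "F = moebius_map \<gamma> ` F0"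
  shows "(\<exists>\<tau>\<in>F. deriv E2 \<tau> = 0) \<longleftrightarrow> \<gamma> $ 2 $ 1 \<noteq> 0"
proof -
  define a b c d where "a = \<gamma> $ 1 $ 1" and "b = \<gamma> $ 1 $ 2" and "c = \<gamma> $ 2 $ 1" and "d = \<gamma> $ 2 $ 2"
  have det: "a * d - b * c = 1" and c: "even c"
    using assms(1) by (auto simp: Gamma0_def det_2 a_def b_def c_def d_def)
  have F: "F = (\<lambda>t. (of_int a * t + of_int b) / (of_int c * t + of_int d)) ` F0"
    unfolding assms(2) moebius_map_def a_def b_def c_def d_def ..
  have F0: "Im t > 0" if "t \<in> F0" for t
    using that by (simp add: mem_F0_iff)
  show ?thesis
  proof (cases "c = 0")
    case True
    then have "a * d = 1" using det by simp
    then have ad: "(a = 1 \<and> d = 1) \<or> (a = - 1 \<and> d = - 1)"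
      using zmult_eq_1_iff by blast
    \<comment> \<open>The map is now a translation by an integer, which leaves \<open>E2'\<close>
      unchanged.\<close>
    have "deriv E2 ((of_int a * t + of_int b) / (of_int c * t + of_int d)) \<noteq> 0" if "t \<in> F0" for t
    proof -
      have "(of_int a * t + of_int b) / (of_int c * t + of_int d) = t + of_int (b * d)"
        using ad True by auto
      then show ?thesis
        using deriv_E2_add_of_int[OF F0[OF that], of "b * d"] deriv_E2_nonzero_F0[OF that] by simp
    qed
    then show ?thesis
      using True by (auto simp: F c_def)
  next
    case False
    define r :: real where "r = - of_int d / of_int c"
    have "odd d"
      using det c by (metis dvd_diff dvd_mult odd_one mult.commute)
    \<comment> \<open>\<open>r = 0\<close> would mean \<open>d = 0\<close>, and \<open>r = 1\<close>
      would mean \<open>d = - c\<close>; both contradict the parity of \<open>d\<close>.\<close>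
    have "r \<noteq> 0" "r \<noteq> 1"
      using \<open>odd d\<close> c False by (auto simp: r_def divide_eq_eq minus_equation_iff[of "of_int d"] simp flip: of_int_minus)
    then obtain t where t: "t \<in> F0" "crit r t = 0"
      using crit_zero_exists by blast
    then have "deriv E2 ((of_int a * t + of_int b) / (of_int c * t + of_int d)) = 0"
      using deriv_E2_moebius[OF det F0[OF t(1)] False] by (simp add: r_def)
    then show ?thesis
      using t(1) False by (auto simp: F c_def)
  qed
qed

end
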